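(* For any set of rank conditions $r$ with dimension vector $(e_0,\dots,e_n)$ and any integer $m\ge0$, \[ K_{r+m}(a^0,1^m,a^1,1^m,\dots,a^n,1^m\,;\,b^0,1^m,\dots,b^n,1^m)=K_r(a^0,\dots,a^n\,;\,b^0,\dots,b^n), \] where $1^m$ denotes $m$ entries equal to $1$ (so for $r+m$ the $i$-th block of $a$-variables is $(a^i_1,\dots,a^i_{e_i},1,\dots,1)$ and similarly for $b$).
   Context: Rank conditions: for $n\ge1$, a family $r=\{r_{ij}\}_{0\le i\le j\le n}$ of non-negative integers with $r_{ij}\le\min(r_{i,j-1},r_{i+1,j})$ for $i<j$ and $r_{ij}+r_{i-1,j+1}\ge r_{i-1,j}+r_{i,j+1}$ for $0<i\le j<n$. Dimension vector $e_i=r_{ii}$; extend by $r_{ij}=e_j+\dots+e_i$ for $j\le i$ and $r_{ij}=0$ if $i<0$ or $j>n$; $N=e_0+\dots+e_n$. For $m\ge0$, $r+m$ denotes the rank conditions $\{r_{ij}+m\}_{0\le i\le j\le n}$ (dimension vector $e_i+m$). Permutations: $S_k$ on $\{1,\dots,k\}$, $(uv)(p)=u(v(p))$, $s_i=(i,i+1)$, $w_0^{(k)}$ longest element of $S_k$. For $0\le i<n$, $0<j\le n$, $W_{ij}\in S_{r_{i+1,j-1}}$: $W_{ij}(p)=p+r_{i,j-1}-r_{ij}$ if $r_{ij}<p\le r_{i+1,j}$; $=p-r_{i+1,j}+r_{ij}$ if $r_{i+1,j}<p\le r_{i+1,j}+r_{i,j-1}-r_{ij}$; $=p$ otherwise.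 $z(r)=\prod_{j=1}^n\prod_{i=0}^{n-1}W_{ij}=(W_{01}\cdots W_{n-1,1})\cdots(W_{0n}\cdots W_{n-1,n})\in S_N$, $\widehat z(r)=w_0^{(N)}z(r)^{-1}w_0^{(N)}$; with $r^e_{ij}=\min(e_i,\dots,e_j)$, $\widehat z(e)=\widehat z(r^e)$. Grothendieck polynomials: for $w\in S_N$, $\mathfrak G_w(a_1..a_N;b_1..b_N)$ is determined by $\mathfrak G_{w_0^{(N)}}=\prod_{p+q\le N}(1-b_p/a_q)$ and, when $w(i)<w(i+1)$, $(a_i-a_{i+1})\mathfrak G_w(a;b)=a_i\mathfrak G_{ws_i}(a;b)-a_{i+1}\mathfrak G_{ws_i}(a_{s_i};b)$ ($a_{s_i}$: $a_i,a_{i+1}$ swapped). Double quiver polynomial: with blocks $a^i=(a^i_1..a^i_{e_i})$, $b^i=(b^i_1..b^i_{e_i})$, $\breve a=(a^n,\dots,a^0)$ and $b=(b^0,\dots,b^n)$ (concatenations), $K_r(a;b)=\mathfrak G_{\widehat z(r)}(\breve a;b)/\mathfrak G_{\widehat z(e)}(\breve a;b)$, where $\mathfrak G_w(\breve a;b)$ means the first argument list is $\breve a$ and the second is $b$. *)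

theory Defs
  imports
    "HOL-Library.Poly_Mapping"
    "HOL-Computational_Algebra.Fraction_Field"
    "HOL-Combinatorics.Permutations"
begin

section \<open>Rational functions in the variables $a^i_p$, $b^i_p$\<close>

text \<open>
  \<^term>\<open>VarA i p\<close> is $a^i_p$ and \<^term>\<open>VarB i p\<close> is $b^i_p$; only indices with $p \ge 1$ are used.
\<close>

datatype qvar = VarA nat nat | VarB nat nat

text \<open>
  The linear order on variables has no mathematical meaning. The library needs some linear order
  to recognise the polynomial ring as an integral domain.
\<close>

fun qvar_code :: "qvar \<Rightarrow> nat \<times> nat \<times> nat" where
  "qvar_code (VarA i p) = (0, i, p)"
| "qvar_code (VarB i p) = (1, i, p)"

instantiation qvar :: linorder
begin

definition less_qvar :: "qvar \<Rightarrow> qvar \<Rightarrow> bool" where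
  "less_qvar x y \<longleftrightarrow>
     (qvar_code x, qvar_code y) \<in> less_than <*lex*> less_than <*lex*> less_than"

definition less_eq_qvar :: "qvar \<Rightarrow> qvar \<Rightarrow> bool" where
  "less_eq_qvar x y \<longleftrightarrow> x = y \<or> x < y"

instance
proof
  fix x y z :: qvar
  show "(x < y) = (x \<le> y \<and> \<not> y \<le> x)"
    by (cases x; cases y) (auto simp: less_qvar_def less_eq_qvar_def)
  show "x \<le> x"
    by (simp add: less_eq_qvar_def)
  show "x \<le> y \<Longrightarrow> y \<le> z \<Longrightarrow> x \<le> z"
    by (cases x; cases y; cases z) (auto simp: less_qvar_def less_eq_qvar_def)
  show "x \<le> y \<Longrightarrow> y \<le> x \<Longrightarrow> x = y"
    by (cases x; cases y) (auto simp: less_qvar_def less_eq_qvar_def)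
  show "x \<le> y \<or> y \<le> x"
    by (cases x; cases y) (auto simp: less_qvar_def less_eq_qvar_def)
qed

end

type_synonym qpoly = "(qvar \<Rightarrow>\<^sub>0 nat) \<Rightarrow>\<^sub>0 int"

type_synonym qratfun = "qpoly fract"

definition var :: "qvar \<Rightarrow> qratfun" where
  "var v = Fract (Poly_Mapping.single (Poly_Mapping.single v 1) 1) 1"

definition monom_subst :: "(qvar \<Rightarrow> 'k::field) \<Rightarrow> (qvar \<Rightarrow>\<^sub>0 nat) \<Rightarrow> 'k" where
  "monom_subst \<sigma> t = (\<Prod>v\<in>Poly_Mapping.keys t. \<sigma> v ^ Poly_Mapping.lookup t v)"

definition poly_subst :: "(qvar \<Rightarrow> 'k::field) \<Rightarrow> qpoly \<Rightarrow> 'k" where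
  "poly_subst \<sigma> P =
     (\<Sum>t\<in>Poly_Mapping.keys P. of_int (Poly_Mapping.lookup P t) * monom_subst \<sigma> t)"

text \<open>
  A substitution need not be defined on every rational function. \<^term>\<open>ratfun_regular \<sigma> F\<close> says
  that \<open>F\<close> can be written with a denominator that does not vanish under \<open>\<sigma>\<close>; only then is
  \<^term>\<open>ratfun_subst \<sigma> F\<close> meaningful, and it does not depend on the representation
  (lemma \<open>ratfun_subst_Fract\<close>).
\<close>

definition ratfun_regular :: "(qvar \<Rightarrow> 'k::field) \<Rightarrow> qratfun \<Rightarrow> bool" where
  "ratfun_regular \<sigma> F \<longleftrightarrow> (\<exists>P Q. F = Fract P Q \<and> poly_subst \<sigma> Q \<noteq> 0)"

definition ratfun_subst :: "(qvar \<Rightarrow> 'k::field) \<Rightarrow> qratfun \<Rightarrow> 'k" where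
  "ratfun_subst \<sigma> F =
     (THE y. \<exists>P Q. F = Fract P Q \<and> poly_subst \<sigma> Q \<noteq> 0 \<and> y = poly_subst \<sigma> P / poly_subst \<sigma> Q)"

lemma monom_subst_superset:
  assumes "finite S" "Poly_Mapping.keys t \<subseteq> S"
  shows "monom_subst \<sigma> t = (\<Prod>v\<in>S. \<sigma> v ^ Poly_Mapping.lookup t v)"
  unfolding monom_subst_def
  by (rule prod.mono_neutral_left) (use assms in \<open>auto simp: in_keys_iff\<close>)

lemma monom_subst_add: "monom_subst \<sigma> (s + t) = monom_subst \<sigma> s * monom_subst \<sigma> t"
proof -
  let ?S = "Poly_Mapping.keys s \<union> Poly_Mapping.keys t"
  have "monom_subst \<sigma> (s + t) = (\<Prod>v\<in>?S. \<sigma> v ^ Poly_Mapping.lookup (s + t) v)"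
    by (rule monom_subst_superset) (simp_all add: Poly_Mapping.keys_add)
  moreover have "monom_subst \<sigma> s = (\<Prod>v\<in>?S. \<sigma> v ^ Poly_Mapping.lookup s v)"
    by (rule monom_subst_superset) auto
  moreover have "monom_subst \<sigma> t = (\<Prod>v\<in>?S. \<sigma> v ^ Poly_Mapping.lookup t v)"
    by (rule monom_subst_superset) auto
  ultimately show ?thesis
    by (simp add: lookup_add power_add prod.distrib)
qed

lemma poly_subst_superset:
  assumes "finite S" "Poly_Mapping.keys P \<subseteq> S"
  shows "poly_subst \<sigma> P = (\<Sum>t\<in>S. of_int (Poly_Mapping.lookup P t) * monom_subst \<sigma> t)"
  unfolding poly_subst_def
  by (rule sum.mono_neutral_left) (use assms in \<open>auto simp: in_keys_iff\<close>)

lemma poly_subst_0 [simp]: "poly_subst \<sigma> 0 = 0"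
  by (simp add: poly_subst_def)

lemma poly_subst_1 [simp]: "poly_subst \<sigma> 1 = 1"
  by (simp add: poly_subst_def monom_subst_def)

lemma poly_subst_add: "poly_subst \<sigma> (P + Q) = poly_subst \<sigma> P + poly_subst \<sigma> Q"
proof -
  let ?S = "Poly_Mapping.keys P \<union> Poly_Mapping.keys Q"
  have "poly_subst \<sigma> (P + Q) =
      (\<Sum>t\<in>?S. of_int (Poly_Mapping.lookup (P + Q) t) * monom_subst \<sigma> t)"
    by (rule poly_subst_superset) (simp_all add: Poly_Mapping.keys_add)
  moreover have "poly_subst \<sigma> P = (\<Sum>t\<in>?S. of_int (Poly_Mapping.lookup P t) * monom_subst \<sigma> t)"
    by (rule poly_subst_superset) auto
  moreover have "poly_subst \<sigma> Q = (\<Sum>t\<in>?S. of_int (Poly_Mapping.lookup Q t) * monom_subst \<sigma> t)"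
    by (rule poly_subst_superset) auto
  ultimately show ?thesis
    by (simp add: lookup_add sum.distrib algebra_simps)
qed

lemma poly_subst_single:
  "poly_subst \<sigma> (Poly_Mapping.single t c) = of_int c * monom_subst \<sigma> t"
  by (cases "c = 0") (auto simp: poly_subst_def)

lemma qpoly_induct [case_names single add]:
  fixes P :: "'a \<Rightarrow>\<^sub>0 'b::comm_monoid_add"
  assumes "\<And>t c. R (Poly_Mapping.single t c)" "\<And>P Q. R P \<Longrightarrow> R Q \<Longrightarrow> R (P + Q)"
  shows "R P"
proof (rule update_induct[of R P])
  show "R 0"
    using assms(1)[of undefined 0] by simp
next
  fix f :: "'a \<Rightarrow>\<^sub>0 'b" and a b
  assume a: "a \<notin> Poly_Mapping.keys f" and "R f"
  have "Poly_Mapping.update a b f = Poly_Mapping.single a b + f"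
    using a by (intro poly_mapping_eqI)
      (auto simp: lookup_add lookup_update lookup_single in_keys_iff when_def)
  with assms \<open>R f\<close> show "R (Poly_Mapping.update a b f)"
    by simp
qed

lemma poly_subst_mult: "poly_subst \<sigma> (P * Q) = poly_subst \<sigma> P * poly_subst \<sigma> Q"
proof (induction P rule: qpoly_induct)
  case (single t c)
  show ?case
  proof (induction Q rule: qpoly_induct)
    case (single u d)
    show ?case
      by (simp add: mult_single poly_subst_single monom_subst_add)
  next
    case (add Q R)
    then show ?case
      by (simp add: distrib_left poly_subst_add)
  qed
next
  case (add P R)
  then show ?case
    by (simp add: distrib_right poly_subst_add)
qed

lemma ratfun_subst_Fract:
  assumes "poly_subst \<sigma> Q \<noteq> 0"
  shows "ratfun_subst \<sigma> (Fract P Q) = poly_subst \<sigma> P / poly_subst \<sigma> Q"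
  unfolding ratfun_subst_def
proof (rule the_equality)
  show "\<exists>P' Q'. Fract P Q = Fract P' Q' \<and> poly_subst \<sigma> Q' \<noteq> 0 \<and>
      poly_subst \<sigma> P / poly_subst \<sigma> Q = poly_subst \<sigma> P' / poly_subst \<sigma> Q'"
    using assms by blast
next
  fix y
  assume "\<exists>P' Q'. Fract P Q = Fract P' Q' \<and> poly_subst \<sigma> Q' \<noteq> 0 \<and>
      y = poly_subst \<sigma> P' / poly_subst \<sigma> Q'"
  then obtain P' Q' where *: "Fract P Q = Fract P' Q'" "poly_subst \<sigma> Q' \<noteq> 0"
      "y = poly_subst \<sigma> P' / poly_subst \<sigma> Q'"
    by blast
  have "Q \<noteq> 0" "Q' \<noteq> 0"
    using assms * by auto
  with * have "P * Q' = P' * Q"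
    by (simp add: eq_fract)
  then have "poly_subst \<sigma> P * poly_subst \<sigma> Q' = poly_subst \<sigma> P' * poly_subst \<sigma> Q"
    by (metis poly_subst_mult)
  with assms * show "y = poly_subst \<sigma> P / poly_subst \<sigma> Q"
    by (simp add: frac_eq_eq)
qed


section \<open>Rank conditions and their permutations\<close>

text \<open>Only the values \<open>r i j\<close> with \<open>i \<le> j \<le> n\<close> belong to the family; all others are ignored.\<close>

definition rank_conditions :: "nat \<Rightarrow> (nat \<Rightarrow> nat \<Rightarrow> nat) \<Rightarrow> bool" where
  "rank_conditions n r \<longleftrightarrow>
     (\<forall>i j. i < j \<and> j \<le> n \<longrightarrow> r i j \<le> min (r i (j - 1)) (r (i + 1) j)) \<and>
     (\<forall>i j. 0 < i \<and> i \<le> j \<and> j < n \<longrightarrow>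
        r i j + r (i - 1) (j + 1) \<ge> r (i - 1) j + r i (j + 1))"

definition dimvec :: "(nat \<Rightarrow> nat \<Rightarrow> nat) \<Rightarrow> nat \<Rightarrow> nat" where
  "dimvec r i = r i i"

definition total_dim :: "nat \<Rightarrow> (nat \<Rightarrow> nat \<Rightarrow> nat) \<Rightarrow> nat" where
  "total_dim n r = (\<Sum>i\<le>n. dimvec r i)"

text \<open>
  The extension of $r_{ij}$ to $j \le i$ and to $j > n$. Its value $0$ for $i < 0$ is not needed,
  as no negative index occurs below.
\<close>

definition rank_ext :: "nat \<Rightarrow> (nat \<Rightarrow> nat \<Rightarrow> nat) \<Rightarrow> nat \<Rightarrow> nat \<Rightarrow> nat" where
  "rank_ext n r i j =
     (if j > n then 0 else if j \<le> i then (\<Sum>k=j..i. dimvec r k) else r i j)"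

definition perm_W :: "nat \<Rightarrow> (nat \<Rightarrow> nat \<Rightarrow> nat) \<Rightarrow> nat \<Rightarrow> nat \<Rightarrow> nat \<Rightarrow> nat" where
  "perm_W n r i j p =
     (let x = rank_ext n r i j; y = rank_ext n r (i + 1) j; z = rank_ext n r i (j - 1) in
        if x < p \<and> p \<le> y then p + z - x
        else if y < p \<and> p \<le> y + z - x then p - y + x
        else p)"

definition zelevinsky :: "nat \<Rightarrow> (nat \<Rightarrow> nat \<Rightarrow> nat) \<Rightarrow> nat \<Rightarrow> nat" where
  "zelevinsky n r = foldr (\<circ>) [perm_W n r i j. j \<leftarrow> [1..<n+1], i \<leftarrow> [0..<n]] id"

definition longest_perm :: "nat \<Rightarrow> nat \<Rightarrow> nat" where
  "longest_perm N p = (if 1 \<le> p \<and> p \<le> N then N + 1 - p else p)"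

definition zelevinsky_hat :: "nat \<Rightarrow> (nat \<Rightarrow> nat \<Rightarrow> nat) \<Rightarrow> nat \<Rightarrow> nat" where
  "zelevinsky_hat n r =
     longest_perm (total_dim n r) \<circ> inv (zelevinsky n r) \<circ> longest_perm (total_dim n r)"

definition max_rank :: "(nat \<Rightarrow> nat) \<Rightarrow> nat \<Rightarrow> nat \<Rightarrow> nat" where
  "max_rank e i j = Min (e ` {i..j})"


section \<open>Double Grothendieck polynomials\<close>

definition perm_ascent :: "nat \<Rightarrow> (nat \<Rightarrow> nat) \<Rightarrow> nat \<Rightarrow> bool" where
  "perm_ascent N w i \<longleftrightarrow> 1 \<le> i \<and> i < N \<and> w i < w (Suc i)"

definition noninversions :: "nat \<Rightarrow> (nat \<Rightarrow> nat) \<Rightarrow> (nat \<times> nat) set" where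
  "noninversions N w = {(p, q). 1 \<le> p \<and> p < q \<and> q \<le> N \<and> w p < w q}"

lemma finite_noninversions: "finite (noninversions N w)"
  by (rule finite_subset[of _ "{1..N} \<times> {1..N}"]) (auto simp: noninversions_def)

lemma card_noninversions_less:
  assumes "perm_ascent N w i"
  shows "card (noninversions N (w \<circ> transpose i (Suc i))) < card (noninversions N w)"
proof -
  let ?s = "transpose i (Suc i)"
  let ?f = "map_prod ?s ?s"
  have inj: "inj ?f"
    by (intro prod.inj_map inj_transpose)
  have "?f ` noninversions N (w \<circ> ?s) \<subseteq> noninversions N w - {(i, Suc i)}"
  proof
    fix x assume "x \<in> ?f ` noninversions N (w \<circ> ?s)"
    then obtain p q where x: "x = (?s p, ?s q)" and
      pq: "1 \<le> p" "p < q" "q \<le> N" "w (?s p) < w (?s q)"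
      by (auto simp: noninversions_def)
    have i: "1 \<le> i" "i < N" "w i < w (Suc i)"
      using assms by (auto simp: perm_ascent_def)
    have "\<not> (p = i \<and> q = Suc i)"
      using pq i by (auto)
    then have "?s p < ?s q"
      using pq unfolding transpose_def by auto
    moreover have "1 \<le> ?s p" "?s q \<le> N"
      using pq i unfolding transpose_def by auto
    moreover have "(?s p, ?s q) \<noteq> (i, Suc i)"
      using pq unfolding transpose_def by (auto split: if_splits)
    ultimately show "x \<in> noninversions N w - {(i, Suc i)}"
      using pq x by (auto simp: noninversions_def)
  qed
  then have "card (?f ` noninversions N (w \<circ> ?s)) \<le> card (noninversions N w - {(i, Suc i)})"
    by (intro card_mono) (simp_all add: finite_noninversions)
  then have "card (noninversions N (w \<circ> ?s)) \<le> card (noninversions N w - {(i, Suc i)})"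
    using card_image[OF inj_on_subset[OF inj subset_UNIV]] by simp
  also have "\<dots> < card (noninversions N w)"
    using assms finite_noninversions
    by (intro psubset_card_mono) (auto simp: noninversions_def perm_ascent_def)
  finally show ?thesis .
qed

text \<open>
  \<^term>\<open>grothendieck N w a b\<close> is the value of $\mathfrak G_w$, $w \in S_N$, at field elements
  $a_1, \dots, a_N$ (pairwise distinct) and $b_1, \dots, b_N$. With $a$ and $b$ independent
  variables in a field of rational functions, it is $\mathfrak G_w$ itself. The recursion is
  used at the first ascent; \<open>grothendieck_rec\<close> shows that it then holds at every ascent, so
  together with \<open>grothendieck_longest\<close> the function has its usual characterisation.
\<close>

function grothendieck ::
    "nat \<Rightarrow> (nat \<Rightarrow> nat) \<Rightarrow> (nat \<Rightarrow> 'k::field) \<Rightarrow> (nat \<Rightarrow> 'k) \<Rightarrow> 'k" where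
  "grothendieck N w a b =
     (if \<exists>i. perm_ascent N w i then
        (let i = (LEAST i. perm_ascent N w i); s = transpose i (Suc i) in
           (a i * grothendieck N (w \<circ> s) a b - a (Suc i) * grothendieck N (w \<circ> s) (a \<circ> s) b)
             / (a i - a (Suc i)))
      else (\<Prod>(p, q)\<in>{(p, q). 1 \<le> p \<and> 1 \<le> q \<and> p + q \<le> N}. 1 - b p / a q))"
  by auto
termination
  by (relation "measure (\<lambda>(N, w, a, b). card (noninversions N w))")
    (auto intro: card_noninversions_less LeastI)

declare grothendieck.simps [simp del]

definition demazure :: "nat \<Rightarrow> ((nat \<Rightarrow> 'k) \<Rightarrow> 'k) \<Rightarrow> (nat \<Rightarrow> 'k) \<Rightarrow> 'k::field" where
  "demazure i f a =
     (a i * f a - a (Suc i) * f (a \<circ> transpose i (Suc i))) / (a i - a (Suc i))"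

lemma demazure_commute_aux:
  fixes x y z t :: "'k::field"
  assumes "x \<noteq> y" "z \<noteq> t"
  shows "(x * ((z * f1 - t * f2) / (z - t)) - y * ((z * f3 - t * f4) / (z - t))) / (x - y)
       = (z * ((x * f1 - y * f3) / (x - y)) - t * ((x * f2 - y * f4) / (x - y))) / (z - t)"
proof -
  have "x - y \<noteq> 0" "z - t \<noteq> 0"
    using assms by auto
  then show ?thesis
    by (simp add: divide_simps) (simp add: algebra_simps)
qed

lemma demazure_commute:
  assumes "Suc i < k" "a i \<noteq> a (Suc i)" "a k \<noteq> a (Suc k)"
  shows "demazure i (demazure k f) a = demazure k (demazure i f) a"
proof -
  have "a \<circ> transpose i (Suc i) \<circ> transpose k (Suc k) =
        a \<circ> transpose k (Suc k) \<circ> transpose i (Suc i)"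
    using assms(1) by (auto simp: fun_eq_iff transpose_def)
  moreover have "(a \<circ> transpose i (Suc i)) k = a k" "(a \<circ> transpose i (Suc i)) (Suc k) = a (Suc k)"
      "(a \<circ> transpose k (Suc k)) i = a i" "(a \<circ> transpose k (Suc k)) (Suc i) = a (Suc i)"
    using assms(1) by (auto simp: transpose_def)
  ultimately show ?thesis
    unfolding demazure_def by (simp only: demazure_commute_aux[OF assms(2,3)])
qed

lemma demazure_braid_aux:
  fixes x y z :: "'k::field"
  assumes "x \<noteq> y" "y \<noteq> z" "x \<noteq> z"
  shows "(x * ((y * ((x * f1 - y * f2) / (x - y)) - z * ((x * f3 - z * f4) / (x - z))) / (y - z))
          - y * ((x * ((y * f2 - x * f1) / (y - x)) - z * ((y * f5 - z * f6) / (y - z))) / (x - z)))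
           / (x - y)
       = (y * ((x * ((y * f1 - z * f3) / (y - z)) - y * ((x * f2 - z * f5) / (x - z))) / (x - y))
          - z * ((x * ((z * f3 - y * f1) / (z - y)) - z * ((x * f4 - y * f6) / (x - y))) / (x - z)))
           / (y - z)"
proof -
  have nz: "x - y \<noteq> 0" "y - z \<noteq> 0" "x - z \<noteq> 0"
    using assms by auto
  have flip: "(y * f2 - x * f1) / (y - x) = (x * f1 - y * f2) / (x - y)"
      "(z * f3 - y * f1) / (z - y) = (y * f1 - z * f3) / (y - z)"
    by (metis minus_diff_eq minus_divide_divide)+
  show ?thesis
    unfolding flip using nz by (simp add: divide_simps) (simp add: algebra_simps)
qed

lemma demazure_braid:
  fixes a :: "nat \<Rightarrow> 'k::field"
  assumes k: "k = Suc i" and ne: "a i \<noteq> a k" "a k \<noteq> a (Suc k)" "a i \<noteq> a (Suc k)"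
  shows "demazure i (demazure k (demazure i f)) a = demazure k (demazure i (demazure k f)) a"
proof -
  let ?s = "transpose i k" and ?t = "transpose k (Suc k)"
  have sts: "a \<circ> ?s \<circ> ?t \<circ> ?s = a \<circ> ?t \<circ> ?s \<circ> ?t"
    using k by (auto simp: fun_eq_iff transpose_def)
  have ss: "g \<circ> ?s \<circ> ?s = g" "g \<circ> ?t \<circ> ?t = g" for g :: "nat \<Rightarrow> 'k"
    by (auto simp: fun_eq_iff)
  have ev: "(g \<circ> ?s) i = g k" "(g \<circ> ?s) k = g i" "(g \<circ> ?s) (Suc k) = g (Suc k)"
      "(g \<circ> ?t) i = g i" "(g \<circ> ?t) k = g (Suc k)" "(g \<circ> ?t) (Suc k) = g k" for g :: "nat \<Rightarrow> 'k"
    using k by (auto simp: transpose_def)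
  show ?thesis
    unfolding demazure_def k[symmetric] ev ss sts
    by (rule demazure_braid_aux[OF ne])
qed

lemma grothendieck_rec_demazure:
  fixes a :: "nat \<Rightarrow> 'k::field"
  assumes "perm_ascent N w i" "inj_on a {1..N}"
  shows "grothendieck N w a b = demazure i (\<lambda>a. grothendieck N (w \<circ> transpose i (Suc i)) a b) a"
  using assms
proof (induction "card (noninversions N w)" arbitrary: w i a rule: less_induct)
  case less
  define s where "s j = transpose j (Suc j)" for j :: nat
  define G where "G u = (\<lambda>a. grothendieck N u a b)" for u
  define k where "k = (LEAST k. perm_ascent N w k)"
  have asc_k: "perm_ascent N w k" and "k \<le> i"
    unfolding k_def using less.prems(1) by (auto intro: LeastI Least_le)
  have first: "G w c = demazure k (G (w \<circ> s k)) c" for c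
    unfolding G_def s_def demazure_def using less.prems(1)
    by (subst grothendieck.simps) (auto simp: Let_def k_def)
  have IH: "G u c = demazure j (G (u \<circ> s j)) c"
    if "card (noninversions N u) < card (noninversions N w)" "perm_ascent N u j"
      "inj_on c {1..N}" for u j c
    using less.hyps[OF that] by (simp add: G_def s_def)
  have less_s: "card (noninversions N (u \<circ> s j)) < card (noninversions N u)"
    if "perm_ascent N u j" for u j
    using card_noninversions_less[OF that] by (simp add: s_def)
  have inj_s: "inj_on (c \<circ> s j) {1..N}" if "inj_on c {1..N}" "1 \<le> j" "j < N"
    for c :: "nat \<Rightarrow> 'k" and j
  proof (rule comp_inj_on)
    show "inj_on (s j) {1..N}"
      using inj_on_subset[OF inj_transpose subset_UNIV] by (simp add: s_def)
    have "s j ` {1..N} \<subseteq> {1..N}"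
      using that(2,3) by (auto simp: s_def transpose_def)
    then show "inj_on c (s j ` {1..N})"
      using that(1) inj_on_subset by blast
  qed
  have cong: "demazure j f c = demazure j g c"
    if "perm_ascent N u j" "inj_on c {1..N}" "\<And>d. inj_on d {1..N} \<Longrightarrow> f d = g d"
    for u j f g and c :: "nat \<Rightarrow> 'k"
    using that(3)[OF that(2)] that(3)[of "c \<circ> s j"] inj_s[OF that(2), of j] that(1)
    by (simp add: demazure_def s_def perm_ascent_def)
  have ne: "a p \<noteq> a q" if "1 \<le> p" "p < q" "q \<le> N" for p q
    using inj_onD[OF less.prems(2), of p q] that by auto
  have bnds: "1 \<le> k" "k < N" "1 \<le> i" "i < N" "w k < w (Suc k)" "w i < w (Suc i)"
    using asc_k less.prems(1) by (auto simp: perm_ascent_def)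
  consider "i = k" | "i = Suc k" | "Suc k < i"
    using \<open>k \<le> i\<close> by linarith
  then have "G w a = demazure i (G (w \<circ> s i)) a"
  proof cases
    case 1
    then show ?thesis using first by simp
  next
    case 2
    have asc: "perm_ascent N (w \<circ> s k) i" "perm_ascent N (w \<circ> s k \<circ> s i) k"
      "perm_ascent N (w \<circ> s i) k" "perm_ascent N (w \<circ> s i \<circ> s k) i"
      using bnds 2 by (auto simp: perm_ascent_def s_def transpose_def)
    have eq: "w \<circ> s k \<circ> s i \<circ> s k = w \<circ> s i \<circ> s k \<circ> s i"
      using 2 by (auto simp: fun_eq_iff s_def transpose_def)
    have lt: "card (noninversions N (w \<circ> s k)) < card (noninversions N w)"
      "card (noninversions N (w \<circ> s i)) < card (noninversions N w)"
      "card (noninversions N (w \<circ> s k \<circ> s i)) < card (noninversions N w)"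
      "card (noninversions N (w \<circ> s i \<circ> s k)) < card (noninversions N w)"
      using less_s[OF asc_k] less_s[OF less.prems(1)] less_s[OF asc(1)] less_s[OF asc(3)]
      by linarith+
    let ?F = "G (w \<circ> s k \<circ> s i \<circ> s k)"
    have 1: "G (w \<circ> s k) d = demazure i (demazure k ?F) d" if "inj_on d {1..N}" for d
      using IH[OF lt(1) asc(1) that] cong[OF asc(1) that IH[OF lt(3) asc(2)]] by simp
    have 2: "G (w \<circ> s i) d = demazure k (demazure i ?F) d" if "inj_on d {1..N}" for d
      using IH[OF lt(2) asc(3) that] cong[OF asc(3) that IH[OF lt(4) asc(4)]] by (simp add: eq)
    have "G w a = demazure k (demazure i (demazure k ?F)) a"
      using first cong[OF asc_k less.prems(2) 1] by simp
    also have "\<dots> = demazure i (demazure k (demazure i ?F)) a"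
      using bnds ne \<open>i = Suc k\<close> by (intro demazure_braid) auto
    also have "\<dots> = demazure i (G (w \<circ> s i)) a"
      using cong[OF less.prems(1) less.prems(2) 2] by simp
    finally show ?thesis .
  next
    case 3
    have asc: "perm_ascent N (w \<circ> s k) i" "perm_ascent N (w \<circ> s i) k"
      using bnds 3 by (auto simp: perm_ascent_def s_def transpose_def)
    have eq: "w \<circ> s k \<circ> s i = w \<circ> s i \<circ> s k"
      using 3 by (auto simp: fun_eq_iff s_def transpose_def)
    let ?F = "G (w \<circ> s k \<circ> s i)"
    have 1: "G (w \<circ> s k) d = demazure i ?F d" if "inj_on d {1..N}" for d
      using IH[OF less_s[OF asc_k] asc(1) that] .
    have 2: "G (w \<circ> s i) d = demazure k ?F d" if "inj_on d {1..N}" for d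
      using IH[OF less_s[OF less.prems(1)] asc(2) that] by (simp add: eq)
    have "G w a = demazure k (demazure i ?F) a"
      using first cong[OF asc_k less.prems(2) 1] by simp
    also have "\<dots> = demazure i (demazure k ?F) a"
      using bnds ne 3 by (intro demazure_commute) auto
    also have "\<dots> = demazure i (G (w \<circ> s i)) a"
      using cong[OF less.prems(1) less.prems(2) 2] by simp
    finally show ?thesis .
  qed
  then show ?case
    by (simp add: G_def s_def)
qed

theorem grothendieck_rec:
  fixes a :: "nat \<Rightarrow> 'k::field"
  assumes "inj_on a {1..N}" "1 \<le> i" "i < N" "w i < w (i + 1)"
  shows "(a i - a (i + 1)) * grothendieck N w a b =
     a i * grothendieck N (w \<circ> transpose i (i + 1)) a b
     - a (i + 1) * grothendieck N (w \<circ> transpose i (i + 1)) (a \<circ> transpose i (i + 1)) b"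
proof -
  have "a i \<noteq> a (i + 1)"
    using assms inj_onD[OF assms(1), of i "i + 1"] by auto
  then show ?thesis
    using grothendieck_rec_demazure[of N w i a b] assms
    by (simp add: perm_ascent_def demazure_def)
qed

theorem grothendieck_longest:
  "grothendieck N (longest_perm N) a b =
     (\<Prod>(p, q)\<in>{(p, q). 1 \<le> p \<and> 1 \<le> q \<and> p + q \<le> N}. 1 - b p / a q)"
proof -
  have "\<nexists>i. perm_ascent N (longest_perm N) i"
    by (auto simp: perm_ascent_def longest_perm_def)
  then show ?thesis
    by (subst grothendieck.simps) (simp only: if_False)
qed


section \<open>Double quiver polynomials\<close>

text \<open>The concatenation \<open>x i\<^sub>1, x i\<^sub>2, \<dots>\<close> of blocks of lengths \<open>e i\<^sub>1, e i\<^sub>2, \<dots>\<close>, numbered from 1.\<close>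

definition concat_blocks ::
    "nat list \<Rightarrow> (nat \<Rightarrow> nat) \<Rightarrow> (nat \<Rightarrow> nat \<Rightarrow> 'k) \<Rightarrow> nat \<Rightarrow> 'k" where
  "concat_blocks is e x p = concat [[x i q. q \<leftarrow> [1..<e i + 1]]. i \<leftarrow> is] ! (p - 1)"

definition double_quiver_polynomial :: "nat \<Rightarrow> (nat \<Rightarrow> nat \<Rightarrow> nat) \<Rightarrow> qratfun" where
  "double_quiver_polynomial n r =
     (let N = total_dim n r;
          a = concat_blocks (rev [0..<n+1]) (dimvec r) (\<lambda>i p. var (VarA i p));
          b = concat_blocks [0..<n+1] (dimvec r) (\<lambda>i p. var (VarB i p))
      in grothendieck N (zelevinsky_hat n r) a b
           / grothendieck N (zelevinsky_hat n (max_rank (dimvec r))) a b)"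

text \<open>The $i$-th block, of length \<open>e i\<close>, followed by ones.\<close>

definition pad_ones :: "(nat \<Rightarrow> nat) \<Rightarrow> (nat \<Rightarrow> nat \<Rightarrow> 'k::one) \<Rightarrow> nat \<Rightarrow> nat \<Rightarrow> 'k" where
  "pad_ones e x i p = (if p \<le> e i then x i p else 1)"

end

theory Submission
  imports Defs
begin

text \<open>
  Let the 0-Hecke algebra (\<open>T\<^sub>i\<^sup>2 = - T\<^sub>i\<close>) act on functions of words and put
  \<open>H\<^sub>i(t) = 1 + (1 - t) T\<^sub>i\<close>. Then \<open>H\<^sub>i(s) H\<^sub>i(t) = H\<^sub>i(st)\<close>, the \<open>H\<^sub>i\<close> satisfy the
  Yang-Baxter equation, and $\mathfrak G_w(a;b)$ is the coefficient of \<open>w\<close> in the Fomin-Kirillov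
  product of the \<open>H\<^bsub>p+q-1\<^esub>(b\<^sub>q/a\<^sub>p)\<close>. Arrange the boxes \<open>(p,q)\<close> in blocks. For a Zelevinsky
  permutation, the boxes pairing \<open>a\<^sup>j\<close> with \<open>b\<^sup>i\<close>, \<open>j \<ge> i + 2\<close>, are forced to be crossings;
  they contribute exactly the denominator of the quiver polynomial, and what remains is a product
  involving only pairs with \<open>j = i + 1\<close> or \<open>j = i\<close>.

  Since \<open>w\<close> increases on the blocks of positions and \<open>w\<inverse>\<close> on those of values, only the block of each
  value matters. Passing from \<open>r\<close> to \<open>r + 1\<close> adds the letter \<open>j - 1\<close> in front of the word of the
  \<open>j\<close>-th block (\<open>j \<ge> 1\<close>) and the letter \<open>n\<close> at the end of the word of block \<open>0\<close>. If the last
  variables of all blocks are equal to \<open>c\<close>, the factor \<open>H(c/c)\<close> is \<open>1\<close>, so in each block the row and the column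
  of \<open>c\<close> join to one line. By the Yang-Baxter equation that line slides over the block, where
  it meets only letters in increasing order and therefore disappears.
\<close>

section \<open>0-Hecke operators on words\<close>

text \<open>
  \<open>hecke i t\<close> is right multiplication by \<open>1 + (1 - t) T\<^sub>i\<close>, written on coefficient functions; \<open>i\<close>
  counts from \<open>0\<close>. It is the identity on words that are too short, so that the relations hold for
  words of every length.
\<close>

definition hecke :: "nat \<Rightarrow> 'k::field \<Rightarrow> (nat list \<Rightarrow> 'k) \<Rightarrow> nat list \<Rightarrow> 'k" where
  "hecke i t X ws =
     (if Suc i < length ws \<and> ws ! Suc i < ws ! i
      then t * X ws + (1 - t) * X (ws[i := ws ! Suc i, Suc i := ws ! i]) else X ws)"

fun hecke_row :: "nat \<Rightarrow> 'k::field \<Rightarrow> 'k list \<Rightarrow> (nat list \<Rightarrow> 'k) \<Rightarrow> nat list \<Rightarrow> 'k" where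
  "hecke_row i x [] X = X"
| "hecke_row i x (g # gs) X = hecke i (g / x) (hecke_row (Suc i) x gs X)"

text \<open>A staircase: each row starts one position after the previous one and loses the last
  column, so nonempty rows all end at position \<open>i + length gs - 2\<close>. Earlier rows are
  applied first, and within a row the rightmost operator is applied first.\<close>

fun hecke_rows :: "nat \<Rightarrow> 'k::field list \<Rightarrow> 'k list \<Rightarrow> (nat list \<Rightarrow> 'k) \<Rightarrow> nat list \<Rightarrow> 'k" where
  "hecke_rows i [] gs X = X"
| "hecke_rows i (x # xs) gs X = hecke_rows (Suc i) xs (butlast gs) (hecke_row i x (butlast gs) X)"

text \<open>Exchanging the letters of a descent gives a word without a descent there, on which the
  inner operator is the identity.\<close>

lemma hecke_merge: "hecke i s (hecke i t X) = hecke i (s * t) X"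
  by (rule ext) (auto simp: hecke_def algebra_simps nth_list_update list_update_swap)

lemma hecke_1 [simp]: "hecke i 1 X = X"
  by (rule ext) (simp add: hecke_def)

lemma hecke_commute:
  assumes "Suc i < j"
  shows "hecke i s (hecke j t X) = hecke j t (hecke i s X)"
proof
  fix ws :: "nat list"
  have "ws[j := y, Suc j := z, i := u, Suc i := v] = ws[i := u, Suc i := v, j := y, Suc j := z]"
    if "Suc j < length ws" for y z u v
    using assms that by (intro nth_equalityI) (auto simp: nth_list_update)
  then show "hecke i s (hecke j t X) ws = hecke j t (hecke i s X) ws"
    using assms by (auto simp: hecke_def algebra_simps)
qed

text \<open>The Yang-Baxter equation. With letters at all three positions it is checked for every
  relative order of these letters.\<close>

lemma hecke_braid:
  "hecke i t (hecke (Suc i) (s * t) (hecke i s X)) = hecke (Suc i) s (hecke i (s * t) (hecke (Suc i) t X))"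
proof
  fix ws :: "nat list"
  consider "length ws \<le> Suc i" | "length ws = Suc (Suc i)" | "Suc (Suc i) < length ws" by linarith
  then show "hecke i t (hecke (Suc i) (s * t) (hecke i s X)) ws =
      hecke (Suc i) s (hecke i (s * t) (hecke (Suc i) t X)) ws"
  proof cases
    case 1
    then show ?thesis by (simp add: hecke_def)
  next
    \<comment> \<open>The word ends at position \<open>Suc i\<close>: the operators at
      \<open>Suc i\<close> are the identity, and the equation becomes the merging rule.\<close>
    case 2
    have "hecke (Suc i) u Y vs = Y vs" if "length vs = Suc (Suc i)" for u Y vs
      using that by (simp add: hecke_def)
    then have "hecke i t (hecke (Suc i) (s * t) (hecke i s X)) ws = hecke i t (hecke i s X) ws"
      "hecke (Suc i) s (hecke i (s * t) (hecke (Suc i) t X)) ws = hecke i (s * t) X ws"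
      using 2 by (simp_all add: hecke_def)
    then show ?thesis by (simp add: hecke_merge mult.commute)
  next
    case 3
    define us where "us = take i ws"
    obtain x y z vs where "drop i ws = x # y # z # vs"
      using 3 by (metis Cons_nth_drop_Suc Suc_lessD)
    then have ws: "ws = us @ x # y # z # vs" and us: "length us = i"
      using 3 by (simp_all add: us_def) (metis append_take_drop_id)
    have l: "hecke i u Y (us @ x # y # zs) =
        (if y < x then u * Y (us @ x # y # zs) + (1 - u) * Y (us @ y # x # zs) else Y (us @ x # y # zs))"
      for u Y x y zs
      using us by (simp add: hecke_def nth_append list_update_append)
    have r: "hecke (Suc i) u Y (us @ x # y # z # zs) =
        (if z < y then u * Y (us @ x # y # z # zs) + (1 - u) * Y (us @ x # z # y # zs)
         else Y (us @ x # y # z # zs))"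
      for u Y x y z zs
      using us by (simp add: hecke_def nth_append list_update_append)
    show ?thesis
      unfolding ws by (simp add: l r) (auto simp: algebra_simps)
  qed
qed

section \<open>Exchanging variables between rows of a staircase\<close>

lemma hecke_row_commute_high:
  "Suc i < j \<Longrightarrow> hecke i t (hecke_row j x gs X) = hecke_row j x gs (hecke i t X)"
  by (induction gs arbitrary: j) (simp_all add: hecke_commute)

lemma hecke_row_commute_low:
  "i + length gs < j \<Longrightarrow> hecke_row i x gs (hecke j t X) = hecke j t (hecke_row i x gs X)"
proof (induction gs arbitrary: i)
  case (Cons g gs)
  then show ?case
    using hecke_commute[of i j] by simp
qed simp

lemma hecke_row_commute:
  "i + length gs < j \<Longrightarrow>
    hecke_row i x gs (hecke_row j y hs X) = hecke_row j y hs (hecke_row i x gs X)"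
  by (induction hs arbitrary: j) (simp_all add: hecke_row_commute_low)

lemma hecke_rows_commute_high:
  "Suc i < j \<Longrightarrow> hecke i t (hecke_rows j xs gs X) = hecke_rows j xs gs (hecke i t X)"
  by (induction xs arbitrary: j gs X) (simp_all add: hecke_row_commute_high)

lemma hecke_rows_row_commute:
  "i + length gs < j \<Longrightarrow>
    hecke_row i x gs (hecke_rows j ys hs X) = hecke_rows j ys hs (hecke_row i x gs X)"
  by (induction ys arbitrary: j hs X) (simp_all add: hecke_row_commute)

lemma hecke_row_append:
  "hecke_row i x (gs @ hs) X = hecke_row i x gs (hecke_row (i + length gs) x hs X)"
  by (induction gs arbitrary: i) simp_all

text \<open>The crossing of the lines of \<open>x\<close> and \<open>y\<close> passes one column
  after another by the Yang-Baxter equation with parameters \<open>x / y\<close> and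
  \<open>g / x\<close>; in the columns it has passed, the rows have exchanged their
  variables.\<close>

lemma hecke_ladder:
  fixes x y :: "'k::field"
  assumes "x \<noteq> 0" "y \<noteq> 0"
  shows "hecke i (x / y) (hecke_row (Suc i) y gs (hecke_row i x gs X)) =
    hecke_row (Suc i) x gs (hecke_row i y gs (hecke (i + length gs) (x / y) X))"
proof (induction gs arbitrary: i)
  case (Cons g gs)
  have "hecke i (x / y) (hecke (Suc i) (g / y) (hecke i (g / x) Y)) =
      hecke (Suc i) (g / x) (hecke i (g / y) (hecke (Suc i) (x / y) Y))" for Y
    using hecke_braid[of i "x / y" "g / x" Y] assms by simp
  then show ?case
    using Cons[of "Suc i"] by (simp add: hecke_row_commute_high[symmetric])
qed simp

lemma hecke_rows_append:
  "hecke_rows i (xs @ ys) gs X =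
     hecke_rows (i + length xs) ys (take (length gs - length xs) gs) (hecke_rows i xs gs X)"
proof (induction xs arbitrary: i gs X)
  case (Cons x xs)
  then show ?case
    by (simp add: butlast_conv_take min_def)
qed simp

text \<open>The row of \<open>x\<close> has one box more than that of \<open>y\<close>, with some
  parameter \<open>g / x\<close>; the length assumption provides it. The crossing moves through the
  common columns and merges with this box to \<open>g / y\<close>.\<close>

lemma hecke_rows_swap:
  fixes x y :: "'k::field"
  assumes "x \<noteq> 0" "y \<noteq> 0" "Suc (length xs) < length gs"
  shows "hecke (i + length xs) (x / y) (hecke_rows i (xs @ x # y # ys) gs X) =
    hecke_rows i (xs @ y # x # ys) gs X"
proof -
  define hs where "hs = butlast (butlast (take (length gs - length xs) gs))"
  define k where "k = i + length xs"
  define Z where "Z = hecke_rows i xs gs X"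
  let ?g = "take (length gs - length xs) gs"
  have len: "1 < length ?g" using assms(3) by simp
  then obtain g where g: "butlast ?g = hs @ [g]"
    unfolding hs_def by (metis append_butlast_last_id length_butlast length_greater_0_conv zero_less_diff)
  have "hecke k (x / y) (hecke_row (Suc k) y hs (hecke_row k x (hs @ [g]) Z)) =
      hecke_row (Suc k) x hs (hecke_row k y (hs @ [g]) Z)"
    using assms by (simp add: hecke_row_append hecke_ladder hecke_merge)
  then show ?thesis
    by (simp add: hecke_rows_append hecke_rows_commute_high g k_def[symmetric] Z_def[symmetric])
qed

section \<open>Evaluation at a word and locality of the operators\<close>

lemma hecke_at:
  "length us = i \<Longrightarrow> hecke i t X (us @ x # y # vs) =
     (if y < x then t * X (us @ x # y # vs) + (1 - t) * X (us @ y # x # vs) else X (us @ x # y # vs))"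
  by (auto simp: hecke_def nth_append list_update_append)

lemma hecke_short: "length ws \<le> Suc i \<Longrightarrow> hecke i t X ws = X ws"
  by (simp add: hecke_def)

lemma split_at_pair:
  assumes "Suc i < length ws"
  obtains us x y vs where "ws = us @ x # y # vs" "length us = i"
proof
  show "ws = take i ws @ ws ! i # ws ! Suc i # drop (Suc (Suc i)) ws"
    using assms by (metis Cons_nth_drop_Suc Suc_lessD append_take_drop_id)
qed (use assms in simp)

text \<open>Operators look only at rearrangements of the given word. Facts about words of one length
  or with given letters can thus be used inside a product of operators.\<close>

lemma hecke_cong:
  assumes "\<And>vs. mset vs = mset ws \<Longrightarrow> X vs = Y vs"
  shows "hecke i t X ws = hecke i t Y ws"
proof (cases "Suc i < length ws")
  case True
  then obtain us x y vs where "ws = us @ x # y # vs" "length us = i"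
    by (rule split_at_pair)
  then show ?thesis
    using assms by (simp add: hecke_at)
qed (use assms in \<open>simp add: hecke_short\<close>)

lemma hecke_row_cong:
  assumes "\<And>vs. mset vs = mset ws \<Longrightarrow> X vs = Y vs"
  shows "hecke_row i x gs X ws = hecke_row i x gs Y ws"
  using assms
proof (induction gs arbitrary: i ws)
  case (Cons g gs)
  show ?case
    using Cons.prems by (simp, intro hecke_cong Cons.IH) simp
qed simp

lemma hecke_rows_cong:
  assumes "\<And>vs. mset vs = mset ws \<Longrightarrow> X vs = Y vs"
  shows "hecke_rows i xs gs X ws = hecke_rows i xs gs Y ws"
  using assms
proof (induction xs arbitrary: i gs X Y)
  case (Cons x xs)
  show ?case
    using Cons.prems by (simp, intro Cons.IH hecke_row_cong) simp
qed simp

lemma hecke_Cons: "hecke (Suc i) t X (z # us) = hecke i t (\<lambda>v. X (z # v)) us"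
  by (simp add: hecke_def)

lemma hecke_row_Cons: "hecke_row (Suc i) x gs X (z # us) = hecke_row i x gs (\<lambda>v. X (z # v)) us"
  by (induction gs arbitrary: i us) (simp_all add: hecke_Cons)

lemma hecke_rows_Cons:
  "hecke_rows (Suc i) xs gs X (z # us) = hecke_rows i xs gs (\<lambda>v. X (z # v)) us"
  by (induction xs arbitrary: i gs X) (simp_all add: hecke_row_Cons)

lemma hecke_rows_prefix:
  "hecke_rows (length us) xs gs X (us @ vs) = hecke_rows 0 xs gs (\<lambda>v. X (us @ v)) vs"
  by (induction us arbitrary: X) (simp_all add: hecke_rows_Cons)

lemma hecke_scale: "hecke i t (\<lambda>w. c * X w) = (\<lambda>w. c * hecke i t X w)"
  by (rule ext) (auto simp: hecke_def algebra_simps)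

lemma hecke_row_scale: "hecke_row i x gs (\<lambda>w. c * X w) = (\<lambda>w. c * hecke_row i x gs X w)"
  by (induction gs arbitrary: i) (simp_all add: hecke_scale)

lemma hecke_rows_scale: "hecke_rows i xs gs (\<lambda>w. c * X w) = (\<lambda>w. c * hecke_rows i xs gs X w)"
  by (induction xs arbitrary: i gs X) (simp_all add: hecke_row_scale)

lemma hecke_row_zero: "hecke_row i x gs (\<lambda>w. 0) = (\<lambda>w. 0)"
  using hecke_row_scale[of i x gs 0 "\<lambda>w. 0"] by simp

text \<open>
  If \<open>Y\<close> vanishes unless the smallest letters \<open>cs\<close> stand in front, then a larger letter \<open>z\<close> can only
  reach the first place by crossing all of them.
\<close>

lemma hecke_row_forced:
  assumes "length D = length gs" "length cs = length gs" "\<And>c. c \<in> set cs \<Longrightarrow> c < z"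
    and "\<And>U. length U = Suc (length gs + length R) \<Longrightarrow> Y U \<noteq> 0 \<Longrightarrow> take (length gs) U = cs"
  shows "hecke_row 0 x gs Y (z # D @ R) = (\<Prod>g\<leftarrow>gs. 1 - g / x) * Y (D @ z # R)"
  using assms
proof (induction gs arbitrary: D cs Y)
  case (Cons g gs)
  obtain d D' where D: "D = d # D'" using Cons.prems(1) by (cases D) auto
  obtain c cs' where cs: "cs = c # cs'" using Cons.prems(2) by (cases cs) auto
  have c: "c < z" using Cons.prems(3) cs by auto
  have first: "u = c" if "Y (u # v) \<noteq> 0" "length v = Suc (length gs + length R)" for u v
    using Cons.prems(4)[of "u # v"] that cs by simp
  \<comment> \<open>If \<open>z\<close> stays in front, every word reached starts with
    \<open>z\<close>, which exceeds the required first letter \<open>c\<close>.\<close>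
  have z: "hecke_row (Suc 0) x gs Y (z # d # D' @ R) = 0"
  proof -
    have "hecke_row 0 x gs (\<lambda>v. Y (z # v)) (d # D' @ R) = hecke_row 0 x gs (\<lambda>v. 0) (d # D' @ R)"
    proof (rule hecke_row_cong)
      fix vs assume "mset vs = mset (d # D' @ R)"
      then have "length vs = length (d # D' @ R)" by (rule mset_eq_length)
      then show "Y (z # vs) = 0"
        using first[of z vs] c Cons.prems(1) D by auto
    qed
    then show ?thesis by (simp add: hecke_row_Cons hecke_row_zero)
  qed
  have dz: "hecke_row (Suc 0) x gs Y (d # z # D' @ R) = (\<Prod>g\<leftarrow>gs. 1 - g / x) * Y (d # D' @ z # R)"
    unfolding hecke_row_Cons
  proof (rule Cons.IH)
    fix U assume "length U = Suc (length gs + length R)" "Y (d # U) \<noteq> 0"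
    then show "take (length gs) U = cs'"
      using Cons.prems(4)[of "d # U"] cs by simp
  qed (use Cons.prems D cs in auto)
  show ?case
  proof (cases "d < z")
    case True
    then show ?thesis
      using z dz hecke_at[of "[]" 0 "g / x" "hecke_row (Suc 0) x gs Y" z d "D' @ R"]
      by (simp add: D)
  next
    \<comment> \<open>There is no descent, so \<open>z\<close> stays and the left side vanishes. On
      the right the first letter \<open>d\<close> is at least \<open>z\<close>, hence differs from
      \<open>c\<close>.\<close>
    case False
    then have "Y (d # D' @ z # R) = 0"
      using first[of d "D' @ z # R"] c Cons.prems(1) D by auto
    with False show ?thesis
      using z hecke_at[of "[]" 0 "g / x" "hecke_row (Suc 0) x gs Y" z d "D' @ R"]
      by (simp add: D)
  qed
qed simp

section \<open>Rectangles of forced crossings inside a staircase\<close>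

fun hecke_rect :: "nat \<Rightarrow> 'k::field list \<Rightarrow> 'k list \<Rightarrow> (nat list \<Rightarrow> 'k) \<Rightarrow> nat list \<Rightarrow> 'k" where
  "hecke_rect i [] gs X = X"
| "hecke_rect i (x # xs) gs X = hecke_rect (Suc i) xs gs (hecke_row i x gs X)"

lemma hecke_rect_Cons:
  "hecke_rect (Suc i) xs gs X (z # us) = hecke_rect i xs gs (\<lambda>v. X (z # v)) us"
  by (induction xs arbitrary: i X) (simp_all add: hecke_row_Cons)

text \<open>By \<open>hecke_row_forced\<close> the first row carries the first letter of
  \<open>A\<close> past \<open>length gs\<close> letters. With that letter held in front, the
  resulting coefficient function again vanishes unless \<open>cs\<close> follows, so the remaining
  rows are treated in the same way.\<close>

lemma hecke_rect_forced:
  assumes "length A = length xs" "length D = length gs" "length cs = length gs"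
    and "\<And>c z. c \<in> set cs \<Longrightarrow> z \<in> set A \<Longrightarrow> c < z"
    and "\<And>U. length U = length (A @ D @ R) \<Longrightarrow> Y U \<noteq> 0 \<Longrightarrow> take (length gs) U = cs"
  shows "hecke_rect 0 xs gs Y (A @ D @ R) = (\<Prod>x\<leftarrow>xs. \<Prod>g\<leftarrow>gs. 1 - g / x) * Y (D @ A @ R)"
  using assms
proof (induction xs arbitrary: A Y)
  case (Cons x xs)
  then obtain z A' where A: "A = z # A'" by (cases A) auto
  have row: "hecke_row 0 x gs Y (z # D' @ R') = (\<Prod>g\<leftarrow>gs. 1 - g / x) * Y (D' @ z # R')"
    if "length D' = length gs" "length (D' @ R') = length (A' @ D @ R)" for D' R'
    by (rule hecke_row_forced) (use that Cons.prems A in auto)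
  have "hecke_rect 0 xs gs (\<lambda>v. hecke_row 0 x gs Y (z # v)) (A' @ D @ R) =
      (\<Prod>x\<leftarrow>xs. \<Prod>g\<leftarrow>gs. 1 - g / x) * hecke_row 0 x gs Y (z # D @ A' @ R)"
  proof (rule Cons.IH)
    fix U assume U: "length U = length (A' @ D @ R)" "hecke_row 0 x gs Y (z # U) \<noteq> 0"
    have "U = take (length gs) U @ drop (length gs) U" by simp
    then have "Y (take (length gs) U @ z # drop (length gs) U) \<noteq> 0"
      using U Cons.prems(2) row[of "take (length gs) U" "drop (length gs) U"] by auto
    then show "take (length gs) U = cs"
      using Cons.prems(5)[of "take (length gs) U @ z # drop (length gs) U"] U Cons.prems(2) A
      by auto
  qed (use Cons.prems A in auto)
  then show ?case
    using row[of D "A' @ R"] Cons.prems(2) A by (simp add: hecke_rect_Cons)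
qed simp

text \<open>The part of a row over \<open>gs\<close> commutes with the parts over \<open>hs\<close>
  of all later rows, which start at least two positions after its last operator. By the length
  assumption the rows drop only columns of \<open>hs\<close>.\<close>

lemma hecke_rows_split:
  assumes "length xs \<le> length hs"
  shows "hecke_rows i xs (gs @ hs) X = hecke_rect i xs gs (hecke_rows (i + length gs) xs hs X)"
  using assms
proof (induction xs arbitrary: i hs X)
  case (Cons x xs)
  then have "butlast (gs @ hs) = gs @ butlast hs" by (auto simp: butlast_append)
  then show ?case
    using Cons by (simp add: hecke_row_append hecke_rows_row_commute)
qed simp

section \<open>Grothendieck polynomials as coefficients\<close>

declare upt_Suc [simp del]

text \<open>The largest letter stands in front but must end up last, so it crosses all other letters
  in the first row; the later rows do not touch the first position.\<close>

lemma hecke_rows_longest: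
  assumes "length xs = N" "length gs = N"
  shows "hecke_rows 0 xs gs (\<lambda>U. of_bool (U = [1..<N + 1])) (rev [1..<N + 1]) =
    (\<Prod>p<N. \<Prod>q<N - Suc p. 1 - gs ! q / xs ! p)"
  using assms
proof (induction N arbitrary: xs gs)
  case (Suc N)
  obtain x xs' where xs: "xs = x # xs'" using Suc.prems(1) by (cases xs) auto
  let ?\<delta> = "\<lambda>U. of_bool (U = [1..<Suc N + 1])"
  let ?c = "\<Prod>g\<leftarrow>butlast gs. 1 - g / x"
  have row: "hecke_row 0 x (butlast gs) ?\<delta> (Suc N # v) = ?c * of_bool (v = [1..<N + 1])"
    if "length v = N" for v
  proof -
    have "hecke_row 0 x (butlast gs) ?\<delta> (Suc N # v @ []) = ?c * ?\<delta> (v @ [Suc N])"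
      by (rule hecke_row_forced[where cs = "[1..<N + 1]"]) (use Suc.prems(2) that in \<open>auto simp: upt_Suc\<close>)
    then show ?thesis by (simp add: upt_Suc[of "Suc 0" "Suc N"])
  qed
  then have "hecke_rows 0 xs gs ?\<delta> (rev [1..<Suc N + 1]) =
      hecke_rows 0 xs' (butlast gs) (\<lambda>v. ?c * of_bool (v = [1..<N + 1])) (rev [1..<N + 1])"
  proof -
    have "rev [1..<Suc N + 1] = Suc N # rev [1..<N + 1]" by (simp add: upt_Suc)
    then have "hecke_rows 0 xs gs ?\<delta> (rev [1..<Suc N + 1]) = hecke_rows 0 xs' (butlast gs)
        (\<lambda>v. hecke_row 0 x (butlast gs) ?\<delta> (Suc N # v)) (rev [1..<N + 1])"
      by (simp only: xs hecke_rows.simps hecke_rows_Cons)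
    also have "\<dots> = hecke_rows 0 xs' (butlast gs)
        (\<lambda>v. ?c * of_bool (v = [1..<N + 1])) (rev [1..<N + 1])"
    proof (rule hecke_rows_cong, rule row)
      fix vs assume "mset vs = mset (rev [1..<N + 1])"
      from mset_eq_length[OF this] show "length vs = N" by simp
    qed
    finally show ?thesis .
  qed
  also have "\<dots> = ?c * (\<Prod>p<N. \<Prod>q<N - Suc p. 1 - butlast gs ! q / xs' ! p)"
    using Suc.IH[of xs' "butlast gs"] Suc.prems xs by (simp add: hecke_rows_scale)
  also have "?c = (\<Prod>q<N. 1 - gs ! q / x)"
    using Suc.prems(2) by (simp add: prod.list_conv_set_nth atLeast0LessThan nth_butlast)
  also have "(\<Prod>p<N. \<Prod>q<N - Suc p. 1 - butlast gs ! q / xs' ! p) =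
      (\<Prod>p<N. \<Prod>q<N - Suc p. 1 - gs ! q / xs' ! p)"
    using Suc.prems(2) by (intro prod.cong refl) (auto simp: nth_butlast)
  finally show ?case
    unfolding xs prod.lessThan_Suc_shift by (simp add: comp_def)
qed simp

lemma no_ascent_imp_rev:
  assumes "w permutes {1..N}" "\<nexists>i. perm_ascent N w i"
  shows "map w [1..<N + 1] = rev [1..<N + 1]"
proof -
  have desc: "w (Suc i) < w i" if "1 \<le> i" "i < N" for i
    using that assms(2) permutes_inj[OF assms(1)]
    by (metis inj_eq linorder_neqE_nat n_not_Suc_n perm_ascent_def)
  let ?l = "rev (map w [1..<N + 1])"
  have "sorted_wrt (\<lambda>x y. y < x) (map w [1..<N + 1])"
    using desc by (subst sorted_wrt_iff_nth_Suc_transp) (auto simp: transp_def)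
  then have "sorted_wrt (<) ?l"
    by (simp add: sorted_wrt_rev)
  moreover have "set ?l = set [1..<N + 1]"
    using permutes_image[OF assms(1)] by (simp add: atLeastLessThanSuc_atLeastAtMost)
  ultimately have "?l = [1..<N + 1]"
    by (intro strict_sorted_equal) simp_all
  then show ?thesis
    by (metis rev_rev_ident)
qed

lemma longest_product:
  fixes a b :: "nat \<Rightarrow> 'k::field"
  shows "(\<Prod>(p, q)\<in>{(p, q). 1 \<le> p \<and> 1 \<le> q \<and> p + q \<le> N}. 1 - b p / a q) =
    (\<Prod>p<N. \<Prod>q<N - Suc p. 1 - b (Suc q) / a (Suc p))"
proof -
  have "(\<Prod>p<N. \<Prod>q<N - Suc p. 1 - b (Suc q) / a (Suc p)) =
      (\<Prod>(p, q)\<in>Sigma {..<N} (\<lambda>p. {..<N - Suc p}). 1 - b (Suc q) / a (Suc p))"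
    by (rule prod.Sigma) auto
  also have "\<dots> = (\<Prod>(p, q)\<in>{(p, q). 1 \<le> p \<and> 1 \<le> q \<and> p + q \<le> N}. 1 - b p / a q)"
    by (rule prod.reindex_bij_witness[of _ "\<lambda>(p, q). (q - 1, p - 1)" "\<lambda>(p, q). (Suc q, Suc p)"]) auto
  finally show ?thesis by simp
qed

text \<open>Here \<open>g\<close> and \<open>h\<close> stand for the coefficients at the words of
  \<open>w \<circ> s\<close> and \<open>w\<close>, and \<open>h'\<close> for the one at
  \<open>w \<circ> s\<close> after exchanging \<open>x = a i\<close> and
  \<open>y = a (Suc i)\<close>. The solved relation is the recursion of
  \<open>grothendieck\<close>.\<close>

lemma demazure_solve:
  fixes x y g h h' :: "'k::field"
  assumes "x \<noteq> y" "y \<noteq> 0" "h' = x / y * g + (1 - x / y) * h"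
  shows "h = (x * g - y * h') / (x - y)"
  using assms by (simp add: field_simps)

text \<open>Induction along the recursion: exchanging \<open>a i\<close> and
  \<open>a (Suc i)\<close> multiplies the staircase by one operator, and evaluation at the descent
  of \<open>w \<circ> s\<close> gives the recursion.\<close>

theorem grothendieck_eq_hecke_rows:
  fixes a b :: "nat \<Rightarrow> 'k::field"
  assumes "w permutes {1..N}" "inj_on a {1..N}" "\<And>p. 1 \<le> p \<Longrightarrow> p \<le> N \<Longrightarrow> a p \<noteq> 0"
  shows "grothendieck N w a b = hecke_rows 0 (map a [1..<N + 1]) (map b [1..<N + 1])
    (\<lambda>U. of_bool (U = [1..<N + 1])) (map w [1..<N + 1])"
  using assms
proof (induction "card (noninversions N w)" arbitrary: w a rule: less_induct)
  case less
  let ?H = "\<lambda>a. hecke_rows 0 (map a [1..<N + 1]) (map b [1..<N + 1]) (\<lambda>U. of_bool (U = [1..<N + 1]))"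
  show ?case
  proof (cases "\<exists>i. perm_ascent N w i")
    case False
    have "grothendieck N w a b =
        (\<Prod>(p, q)\<in>{(p, q). 1 \<le> p \<and> 1 \<le> q \<and> p + q \<le> N}. 1 - b p / a q)"
      by (subst grothendieck.simps) (simp only: if_not_P[OF False])
    also have "\<dots> = (\<Prod>p<N. \<Prod>q<N - Suc p.
        1 - map b [1..<N + 1] ! q / map a [1..<N + 1] ! p)"
      unfolding longest_product by (intro prod.cong refl) auto
    also have "\<dots> = ?H a (map w [1..<N + 1])"
      unfolding no_ascent_imp_rev[OF less.prems(1) False]
      by (rule hecke_rows_longest[symmetric]) simp_all
    finally show ?thesis .
  next
    case True
    define i where "i = (LEAST i. perm_ascent N w i)"
    define s where "s = transpose i (Suc i)"
    have asc: "perm_ascent N w i"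
      using True unfolding i_def by (rule LeastI_ex)
    then have i: "1 \<le> i" "i < N" "w i < w (Suc i)"
      by (auto simp: perm_ascent_def)
    have s: "s permutes {1..N}"
      unfolding s_def by (rule permutes_swap_id) (use i in auto)
    have ws: "w \<circ> s permutes {1..N}"
      using permutes_compose[OF s less.prems(1)] .
    have lt: "card (noninversions N (w \<circ> s)) < card (noninversions N w)"
      using card_noninversions_less[OF asc] by (simp add: s_def)
    have as: "inj_on (a \<circ> s) {1..N}"
      using less.prems(2) s by (metis comp_inj_on permutes_image permutes_inj_on)
    have as0: "(a \<circ> s) p \<noteq> 0" if "1 \<le> p" "p \<le> N" for p
      using less.prems(3) permutes_in_image[OF s, of p] that by simp
    have ne: "a i \<noteq> a (Suc i)"
      using less.prems(2) i by (auto dest: inj_onD)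
    have upt: "[1..<N + 1] = [1..<i] @ i # Suc i # [Suc (Suc i)..<N + 1]"
    proof -
      have "[1..<N + 1] = [1..<i] @ [i..<N + 1]"
        using upt_add_eq_append[of 1 i "N + 1 - i"] i by simp
      also have "[i..<N + 1] = i # Suc i # [Suc (Suc i)..<N + 1]"
        using i by (simp add: upt_conv_Cons)
      finally show ?thesis .
    qed
    have fs: "map (f \<circ> s) [1..<N + 1] =
        map f [1..<i] @ f (Suc i) # f i # map f [Suc (Suc i)..<N + 1]" for f :: "nat \<Rightarrow> 'b"
      unfolding upt by (auto simp: s_def transpose_def)
    have f: "map f [1..<N + 1] =
        map f [1..<i] @ f i # f (Suc i) # map f [Suc (Suc i)..<N + 1]" for f :: "nat \<Rightarrow> 'b"
      unfolding upt by simp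
    have nz: "a i \<noteq> 0" "a (Suc i) \<noteq> 0"
      using less.prems(3) i by simp_all
    \<comment> \<open>Operators count positions from 0, so the exchange of \<open>a i\<close> and
      \<open>a (Suc i)\<close> corresponds to index \<open>i - 1\<close>.\<close>
    have "hecke (0 + length (map a [1..<i])) (a i / a (Suc i)) (?H a) = ?H (a \<circ> s)"
      unfolding fs f[of a] by (rule hecke_rows_swap) (use i nz in auto)
    then have "?H (a \<circ> s) (map (w \<circ> s) [1..<N + 1]) =
        hecke (i - 1) (a i / a (Suc i)) (?H a) (map (w \<circ> s) [1..<N + 1])"
      by simp
    also have "\<dots> = a i / a (Suc i) * ?H a (map (w \<circ> s) [1..<N + 1]) +
        (1 - a i / a (Suc i)) * ?H a (map w [1..<N + 1])"
      unfolding fs[of w] f[of w] by (subst hecke_at) (use i in auto)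
    finally have H: "?H a (map w [1..<N + 1]) =
        (a i * ?H a (map (w \<circ> s) [1..<N + 1]) -
          a (Suc i) * ?H (a \<circ> s) (map (w \<circ> s) [1..<N + 1])) / (a i - a (Suc i))"
      by (rule demazure_solve[OF ne nz(2)])
    have IH: "grothendieck N (w \<circ> s) a b = ?H a (map (w \<circ> s) [1..<N + 1])"
      "grothendieck N (w \<circ> s) (a \<circ> s) b = ?H (a \<circ> s) (map (w \<circ> s) [1..<N + 1])"
      by (rule less.hyps[OF lt ws], fact less.prems(2), fact less.prems(3))
        (rule less.hyps[OF lt ws], fact as, rule as0)
    have "grothendieck N w a b =
        (a i * grothendieck N (w \<circ> s) a b - a (Suc i) * grothendieck N (w \<circ> s) (a \<circ> s) b)
          / (a i - a (Suc i))"
      by (subst grothendieck.simps)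
        (simp only: if_P[OF True] Let_def i_def[symmetric] s_def[symmetric])
    then show ?thesis
      by (simp only: IH H)
  qed
qed

text \<open>
  A word with values \<open>1, \<dots>, N\<close> in which letters with the same \<open>f\<close>-value increase is determined by its
  image under \<open>f\<close>.
\<close>

definition standard_word :: "(nat \<Rightarrow> nat) \<Rightarrow> nat \<Rightarrow> nat list \<Rightarrow> bool" where
  "standard_word f N ws \<longleftrightarrow> mset ws = mset [1..<N + 1] \<and> sorted_wrt (\<lambda>x y. f x = f y \<longrightarrow> x < y) ws"

lemma standard_wordD:
  assumes "standard_word f N ws"
  shows "length ws = N" "set ws = {1..N}" "distinct ws"
proof -
  have ms: "mset ws = mset [1..<N + 1]" using assms by (simp only: standard_word_def)
  show "length ws = N"
    unfolding mset_eq_length[OF ms] by simp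
  show "set ws = {1..N}"
    unfolding mset_eq_setD[OF ms] by (simp add: atLeastLessThanSuc_atLeastAtMost)
  show "distinct ws" using mset_eq_imp_distinct_iff[OF ms] by simp
qed

text \<open>Letters forming a descent of a standard word have different \<open>f\<close>-values. By
  monotonicity the labels descend as well, and exchanging the letters gives a standard word again.
  At an ascent the labels do not descend.\<close>

lemma hecke_standard_word:
  assumes "\<And>ws. standard_word f N ws \<Longrightarrow> X ws = Y (map f ws)"
    and f: "mono_on {1..N} f" and ws: "standard_word f N ws"
  shows "hecke i t X ws = hecke i t Y (map f ws)"
proof (cases "Suc i < length ws")
  case True
  then obtain us x y vs where *: "ws = us @ x # y # vs" "length us = i"
    by (rule split_at_pair)
  have xy: "x \<in> {1..N}" "y \<in> {1..N}" "x \<noteq> y"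
    using standard_wordD[OF ws] unfolding * by auto
  show ?thesis
  proof (cases "x < y")
    case True
    then have "f x \<le> f y" using xy by (intro mono_onD[OF f]) auto
    with True show ?thesis using assms(1)[OF ws] * by (simp add: hecke_at)
  next
    case False
    then have "y < x" using xy by simp
    moreover have "f x \<noteq> f y"
      using ws False by (auto simp: standard_word_def * sorted_wrt_append)
    moreover have "f y \<le> f x" using xy \<open>y < x\<close> by (intro mono_onD[OF f]) auto
    moreover have "standard_word f N (us @ y # x # vs)"
      using ws \<open>f x \<noteq> f y\<close>
      by (simp add: standard_word_def * sorted_wrt_append add_mset_commute del: mset_upt)
    ultimately show ?thesis
      using assms(1)[OF ws] assms(1)[of "us @ y # x # vs"] * by (simp add: hecke_at)
  qed
qed (use assms in \<open>simp add: hecke_short\<close>)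

lemma hecke_row_standard_word:
  assumes "\<And>ws. standard_word f N ws \<Longrightarrow> X ws = Y (map f ws)"
    and "mono_on {1..N} f" and "standard_word f N ws"
  shows "hecke_row i x gs X ws = hecke_row i x gs Y (map f ws)"
  using assms(3)
proof (induction gs arbitrary: i ws)
  case (Cons g gs)
  show ?case
    unfolding hecke_row.simps by (rule hecke_standard_word[OF _ assms(2) Cons.prems], rule Cons.IH)
qed (simp add: assms(1))

lemma hecke_rows_standard_word:
  assumes "\<And>ws. standard_word f N ws \<Longrightarrow> X ws = Y (map f ws)"
    and "mono_on {1..N} f" and "standard_word f N ws"
  shows "hecke_rows i xs gs X ws = hecke_rows i xs gs Y (map f ws)"
  using assms(1)
proof (induction xs arbitrary: i gs X Y)
  case (Cons x xs)
  show ?case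
    unfolding hecke_rows.simps
    by (rule Cons.IH, rule hecke_row_standard_word[OF _ assms(2)], rule Cons.prems)
qed (simp add: assms(3))

text \<open>Translates the delta function at which the product starts into one on labels: equality
  of the labels forces \<open>ws\<close> to increase.\<close>

lemma standard_word_eq_iff:
  assumes f: "mono_on {1..N} f" and ws: "standard_word f N ws"
  shows "map f ws = map f [1..<N + 1] \<longleftrightarrow> ws = [1..<N + 1]"
proof
  assume eq: "map f ws = map f [1..<N + 1]"
  have std: "sorted_wrt (\<lambda>x y. f x = f y \<longrightarrow> x < y) ws"
    using ws by (simp only: standard_word_def)
  note len = standard_wordD(1)[OF ws] and set = standard_wordD(2)[OF ws]
  have "sorted_wrt (<) ws"
    unfolding sorted_wrt_iff_nth_less
  proof (intro allI impI)
    fix p q assume pq: "p < q" "q < length ws"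
    have "f (ws ! k) = f (Suc k)" if "k < N" for k
      using arg_cong[OF eq, of "\<lambda>l. l ! k"] that len by simp
    then have "f (ws ! p) = f (Suc p)" "f (ws ! q) = f (Suc q)"
      using pq len by simp_all
    moreover have "f (Suc p) \<le> f (Suc q)"
      using pq len by (intro mono_onD[OF f]) auto
    ultimately have le: "f (ws ! p) \<le> f (ws ! q)" by simp
    show "ws ! p < ws ! q"
    proof (cases "f (ws ! p) = f (ws ! q)")
      case True
      then show ?thesis using std pq by (auto simp: sorted_wrt_iff_nth_less)
    next
      case False
      have "ws ! p \<in> {1..N}" "ws ! q \<in> {1..N}" using pq set by (metis nth_mem less_trans)+
      then show ?thesis using le False mono_onD[OF f, of "ws ! q" "ws ! p"] by force
    qed
  qed
  then show "ws = [1..<N + 1]"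
    by (intro strict_sorted_equal) (simp_all add: set atLeastLessThanSuc_atLeastAtMost)
qed simp

section \<open>Removing the forced crossings\<close>

text \<open>
  \<open>quiver_state n a b W d\<close> describes the product after the row blocks \<open>n, \<dots>, n - d + 1\<close>, with words
  \<open>W n, \<dots>\<close>, as a function of the letters left over for the next block. The column block \<open>n - d - 1\<close>
  enters with that next block, hence its letters are still all equal.
\<close>

fun quiver_state ::
    "nat \<Rightarrow> (nat \<Rightarrow> 'k::field list) \<Rightarrow> (nat \<Rightarrow> 'k list) \<Rightarrow> (nat \<Rightarrow> nat list) \<Rightarrow> nat \<Rightarrow> nat list \<Rightarrow> 'k"
  where
  "quiver_state n a b W 0 V = of_bool (V = replicate (length (b n)) n)"
| "quiver_state n a b W (Suc d) V =
     hecke_rows 0 (a (n - d)) (b (n - Suc d) @ b (n - d))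
       (\<lambda>U. if take (length (b (n - Suc d))) U = replicate (length (b (n - Suc d))) (n - Suc d)
            then quiver_state n a b W d (drop (length (b (n - Suc d))) U) else 0)
       (W (n - d) @ V)"

definition quiver_value ::
    "nat \<Rightarrow> (nat \<Rightarrow> 'k::field list) \<Rightarrow> (nat \<Rightarrow> 'k list) \<Rightarrow> (nat \<Rightarrow> nat list) \<Rightarrow> 'k" where
  "quiver_value n a b W = hecke_rows 0 (a 0) (b 0) (quiver_state n a b W n) (W 0)"

definition block_word :: "(nat \<Rightarrow> nat) \<Rightarrow> nat \<Rightarrow> nat list" where
  "block_word e k = concat (map (\<lambda>l. replicate (e l) l) [0..<k])"

text \<open>The same bookkeeping before forced crossings are removed: row block \<open>n - d\<close>
  meets all column blocks \<open>0\<close>, ..., \<open>n - d\<close>, and \<open>V\<close> holds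
  the letters for all later blocks.\<close>

fun full_state ::
    "nat \<Rightarrow> (nat \<Rightarrow> 'k::field list) \<Rightarrow> (nat \<Rightarrow> 'k list) \<Rightarrow> (nat \<Rightarrow> nat list) \<Rightarrow> nat \<Rightarrow> nat list \<Rightarrow> 'k"
  where
  "full_state n a b W 0 U = of_bool (U = block_word (\<lambda>l. length (b l)) (Suc n))"
| "full_state n a b W (Suc d) V =
     hecke_rows 0 (a (n - d)) (concat (map b [0..<Suc (n - d)])) (full_state n a b W d) (W (n - d) @ V)"

definition crossing_factor :: "(nat \<Rightarrow> 'k::field list) \<Rightarrow> (nat \<Rightarrow> 'k list) \<Rightarrow> nat \<Rightarrow> 'k" where
  "crossing_factor a b j = (\<Prod>x\<leftarrow>a j. \<Prod>g\<leftarrow>concat (map b [0..<j - 1]). 1 - g / x)"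

lemma hecke_rows_zero: "hecke_rows i xs gs (\<lambda>w. 0) w = 0"
  using hecke_rows_scale[of i xs gs 0 "\<lambda>w. 0"] by simp

lemma block_word_Suc: "block_word e (Suc k) = block_word e k @ replicate (e k) k"
  by (simp add: block_word_def upt_Suc)

lemma length_block_word:
  "length (block_word (\<lambda>l. length (b l)) k) = length (concat (map b [0..<k]))"
  by (induction k) (simp_all add: block_word_Suc upt_Suc, simp add: block_word_def)

lemma set_block_word: "x \<in> set (block_word e k) \<Longrightarrow> x < k"
  by (auto simp: block_word_def)

text \<open>Later row blocks act behind the letters of \<open>W (n - d)\<close>, which stay fixed as
  a prefix. Dropping one column per row removes exactly the last column block.\<close>

lemma full_state_value:
  assumes len: "\<And>j. j \<le> n \<Longrightarrow> length (a j) = length (b j)" "\<And>j. j \<le> n \<Longrightarrow> length (W j) = length (b j)"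
  shows "hecke_rows 0 (concat (map a (rev [0..<Suc n]))) (concat (map b [0..<Suc n]))
      (full_state n a b W 0) (concat (map W (rev [0..<Suc n]))) =
    hecke_rows 0 (a 0) (b 0) (full_state n a b W n) (W 0)"
proof -
  have "hecke_rows 0 (concat (map a (rev [0..<Suc n]))) (concat (map b [0..<Suc n]))
      (full_state n a b W 0) (concat (map W (rev [0..<Suc n]))) =
    hecke_rows 0 (concat (map a (rev [0..<Suc (n - d)]))) (concat (map b [0..<Suc (n - d)]))
      (full_state n a b W d) (concat (map W (rev [0..<Suc (n - d)])))" if "d \<le> n" for d
    using that
  proof (induction d)
    case (Suc d)
    define k where "k = n - Suc d"
    have k: "n - d = Suc k" using Suc.prems by (simp add: k_def)
    have l: "length (a (Suc k)) = length (W (Suc k))" "length (b (Suc k)) = length (a (Suc k))"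
      using len k by (metis diff_le_self)+
    have gs: "concat (map b [0..<Suc (Suc k)]) = concat (map b [0..<Suc k]) @ b (Suc k)"
      by (simp add: upt_Suc)
    have rev: "concat (map f (rev [0..<Suc (Suc k)])) = f (Suc k) @ concat (map f (rev [0..<Suc k]))"
      for f :: "nat \<Rightarrow> 'b list"
      by (simp add: upt_Suc)
    have fs: "full_state n a b W (Suc d) = (\<lambda>V. hecke_rows 0 (a (Suc k)) (concat (map b [0..<Suc k]) @ b (Suc k))
       (full_state n a b W d) (W (Suc k) @ V))"
      by (rule ext) (simp only: full_state.simps k gs)
    show ?case
      using Suc.IH Suc.prems
      unfolding k rev k_def[symmetric] fs
      unfolding gs hecke_rows_append
      by (simp add: l hecke_rows_prefix)
  qed simp
  from this[of n] show ?thesis by (simp add: upt_Suc)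
qed

text \<open>\<open>D\<close> lies over the column blocks below \<open>n - d\<close>,
  \<open>V\<close> over block \<open>n - d\<close>. In row block \<open>k + 1\<close> the letters of
  \<open>W (k + 1)\<close> are at least \<open>k\<close>, while the prefix must be the sorted word
  of letters below \<open>k\<close>. So all of them cross \<open>D\<close>, and the columns of the
  blocks \<open>k\<close> and \<open>k + 1\<close> remain.\<close>

lemma full_state_factor:
  assumes len: "\<And>j. j \<le> n \<Longrightarrow> length (a j) = length (b j)" "\<And>j. j \<le> n \<Longrightarrow> length (W j) = length (b j)"
    and W: "\<And>j x. j \<le> n \<Longrightarrow> x \<in> set (W j) \<Longrightarrow> j - 1 \<le> x"
    and "d \<le> n" "length D = length (concat (map b [0..<n - d]))" "length V = length (b (n - d))"
  shows "full_state n a b W d (D @ V) = (\<Prod>i<d. crossing_factor a b (n - i)) *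
    of_bool (D = block_word (\<lambda>l. length (b l)) (n - d)) * quiver_state n a b W d V"
  using assms(4-)
proof (induction d arbitrary: D V)
  case 0
  then show ?case by (auto simp: block_word_Suc length_block_word)
next
  case (Suc d)
  define k where "k = n - Suc d"
  have k: "n - d = Suc k" using Suc.prems by (simp add: k_def)
  define gs where "gs = concat (map b [0..<k])"
  define hs where "hs = b k @ b (Suc k)"
  define w where "w = (\<lambda>k. block_word (\<lambda>l. length (b l)) k)"
  define c where "c = (\<Prod>i<d. crossing_factor a b (n - i))"
  define \<Psi> where "\<Psi> = (\<lambda>U. if take (length (b k)) U = replicate (length (b k)) k
            then quiver_state n a b W d (drop (length (b k)) U) else 0)"
  let ?X = "full_state n a b W d"
  have l: "length (a (Suc k)) = length (b (Suc k))" "length (W (Suc k)) = length (b (Suc k))"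
    using len k by (metis diff_le_self)+
  have D: "length D = length gs" and V: "length V = length (b k)"
    using Suc.prems by (simp_all add: gs_def k_def)
  \<comment> \<open>This is the induction hypothesis, with the condition on the letters over block
    \<open>k\<close> moved into \<open>\<Psi>\<close>.\<close>
  have X: "?X (D' @ U) = c * of_bool (D' = w k) * \<Psi> U"
    if "length D' = length gs" "length U = length hs" for D' U
  proof -
    have "U = take (length (b k)) U @ drop (length (b k)) U" by simp
    moreover have "?X ((D' @ take (length (b k)) U) @ drop (length (b k)) U) =
        c * of_bool (D' @ take (length (b k)) U = w (Suc k)) * quiver_state n a b W d (drop (length (b k)) U)"
      unfolding c_def w_def k[symmetric]
      by (rule Suc.IH) (use Suc.prems that in \<open>simp_all add: k gs_def hs_def upt_Suc\<close>)
    moreover have "D' @ take (length (b k)) U = w (Suc k) \<longleftrightarrow>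
        D' = w k \<and> take (length (b k)) U = replicate (length (b k)) k"
      using that(1) by (simp add: w_def block_word_Suc length_block_word gs_def)
    ultimately show ?thesis by (simp add: \<Psi>_def)
  qed
  have gs: "concat (map b [0..<Suc (Suc k)]) = gs @ hs"
    by (simp add: gs_def hs_def upt_Suc)
  have "full_state n a b W (Suc d) (D @ V) =
      hecke_rect 0 (a (Suc k)) gs (hecke_rows (length gs) (a (Suc k)) hs ?X) (W (Suc k) @ D @ V)"
    unfolding full_state.simps k gs by (subst hecke_rows_split) (simp_all add: hs_def l)
  also have "\<dots> = (\<Prod>x\<leftarrow>a (Suc k). \<Prod>g\<leftarrow>gs. 1 - g / x) *
      hecke_rows (length gs) (a (Suc k)) hs ?X (D @ W (Suc k) @ V)"
  proof (rule hecke_rect_forced[where cs = "w k"])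
    show "length (w k) = length gs" by (simp add: w_def length_block_word gs_def)
  next
    fix x z assume "x \<in> set (w k)" "z \<in> set (W (Suc k))"
    then show "x < z"
      using W[of "Suc k" z] k set_block_word[of x "\<lambda>l. length (b l)" k] by (fastforce simp: w_def)
  next
    \<comment> \<open>The inner staircase starts behind the columns \<open>gs\<close>, so the
      condition on the prefix passes through it unchanged.\<close>
    fix U assume U: "length U = length (W (Suc k) @ D @ V)"
      "hecke_rows (length gs) (a (Suc k)) hs ?X U \<noteq> 0"
    define P where "P = take (length gs) U"
    define Q where "Q = drop (length gs) U"
    have PQ: "U = P @ Q" "length P = length gs" "length Q = length hs"
      using U D V l by (simp_all add: P_def Q_def hs_def)
    have "hecke_rows (length P) (a (Suc k)) hs ?X (P @ Q) =
        hecke_rows 0 (a (Suc k)) hs (\<lambda>U. c * of_bool (P = w k) * \<Psi> U) Q"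
      unfolding hecke_rows_prefix
    proof (rule hecke_rows_cong, rule X)
      fix vs assume "mset vs = mset Q"
      from mset_eq_length[OF this] show "length vs = length hs" using PQ by simp
    qed (use PQ in simp)
    then have "P \<noteq> w k \<Longrightarrow> hecke_rows (length P) (a (Suc k)) hs ?X (P @ Q) = 0"
      by (simp add: hecke_rows_zero)
    then have "P = w k"
      using U(2) unfolding PQ(2)[symmetric] PQ(1)[symmetric] by blast
    then show "take (length gs) U = w k"
      by (simp add: P_def)
  qed (use D l in simp_all)
  also have "(\<Prod>x\<leftarrow>a (Suc k). \<Prod>g\<leftarrow>gs. 1 - g / x) = crossing_factor a b (n - d)"
    by (simp add: crossing_factor_def k gs_def)
  also have "hecke_rows (length gs) (a (Suc k)) hs ?X (D @ W (Suc k) @ V) =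
      hecke_rows 0 (a (Suc k)) hs (\<lambda>U. ?X (D @ U)) (W (Suc k) @ V)"
    by (simp add: hecke_rows_prefix D[symmetric])
  also have "\<dots> = hecke_rows 0 (a (Suc k)) hs (\<lambda>U. c * of_bool (D = w k) * \<Psi> U) (W (Suc k) @ V)"
  proof (rule hecke_rows_cong, rule X)
    fix vs assume "mset vs = mset (W (Suc k) @ V)"
    from mset_eq_length[OF this] show "length vs = length hs" using V l by (simp add: hs_def)
  qed (use D in simp)
  also have "\<dots> = c * of_bool (D = w k) * quiver_state n a b W (Suc d) V"
    unfolding quiver_state.simps k k_def[symmetric] by (simp add: hecke_rows_scale \<Psi>_def hs_def)
  finally show ?case
    by (simp add: c_def w_def k_def)
qed

theorem full_state_eq_quiver_value:
  assumes len: "\<And>j. j \<le> n \<Longrightarrow> length (a j) = length (b j)" "\<And>j. j \<le> n \<Longrightarrow> length (W j) = length (b j)"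
    and W: "\<And>j x. j \<le> n \<Longrightarrow> x \<in> set (W j) \<Longrightarrow> j - 1 \<le> x"
  shows "hecke_rows 0 (concat (map a (rev [0..<Suc n]))) (concat (map b [0..<Suc n]))
      (\<lambda>U. of_bool (U = block_word (\<lambda>l. length (b l)) (Suc n))) (concat (map W (rev [0..<Suc n]))) =
    (\<Prod>i<n. crossing_factor a b (n - i)) * quiver_value n a b W"
proof -
  have start: "full_state n a b W 0 = (\<lambda>U. of_bool (U = block_word (\<lambda>l. length (b l)) (Suc n)))"
    by (rule ext) simp
  have "hecke_rows 0 (concat (map a (rev [0..<Suc n]))) (concat (map b [0..<Suc n]))
      (\<lambda>U. of_bool (U = block_word (\<lambda>l. length (b l)) (Suc n))) (concat (map W (rev [0..<Suc n]))) =
    hecke_rows 0 (a 0) (b 0) (full_state n a b W n) (W 0)"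
    unfolding start[symmetric] by (rule full_state_value) (simp_all add: len)
  also have "\<dots> = hecke_rows 0 (a 0) (b 0)
      (\<lambda>U. (\<Prod>i<n. crossing_factor a b (n - i)) * quiver_state n a b W n U) (W 0)"
  proof (rule hecke_rows_cong)
    fix vs assume "mset vs = mset (W 0)"
    from mset_eq_length[OF this] have "length vs = length (b 0)" using len by simp
    then show "full_state n a b W n vs = (\<Prod>i<n. crossing_factor a b (n - i)) * quiver_state n a b W n vs"
      using full_state_factor[OF len W, where d = n and D = "[]" and V = vs] by (simp add: block_word_def)
  qed
  finally show ?thesis by (simp add: hecke_rows_scale quiver_value_def)
qed

section \<open>Sliding the line of a variable over a block\<close>

fun hecke_col :: "nat \<Rightarrow> 'k::field \<Rightarrow> 'k list \<Rightarrow> (nat list \<Rightarrow> 'k) \<Rightarrow> nat list \<Rightarrow> 'k" where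
  "hecke_col i c [] X = X"
| "hecke_col i c (x # xs) X = hecke_col (Suc i) c xs (hecke i (c / x) X)"

lemma hecke_col_sorted: "sorted (take (Suc (i + length xs)) ws) \<Longrightarrow> hecke_col i c xs X ws = X ws"
proof (induction xs arbitrary: i X)
  case (Cons x xs)
  have "ws ! i \<le> ws ! Suc i" if "Suc i < length ws"
    using sorted_nth_mono[OF Cons.prems, of i "Suc i"] that by simp
  then have "hecke i (c / x) X ws = X ws"
    by (auto simp: hecke_def)
  then show ?case
    using Cons.IH[of "Suc i"] Cons.prems by simp
qed simp

text \<open>The length assumption makes the row of \<open>c\<close> end at the column of
  \<open>c\<close>, where the box has parameter 1 and disappears; this joins row and column. By
  \<open>hecke_ladder\<close> the line then passes each other row: its row part comes to act first,
  its box \<open>c / x\<close> after that row.\<close>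

lemma hecke_rows_slide:
  fixes c :: "'k::field"
  assumes "c \<noteq> 0" "0 \<notin> set xs" "length hs = Suc (length xs)"
  shows "hecke_rows i (xs @ [c]) (gs @ c # hs) X =
    hecke_col i c xs (hecke_rows (Suc i) xs (gs @ hs) (hecke_row i c gs X))"
  using assms(2,3)
proof (induction xs arbitrary: i hs X)
  case Nil
  then obtain h where "hs = [h]" by (cases hs) auto
  then show ?case by (simp add: hecke_row_append butlast_append assms(1))
next
  case (Cons x xs)
  define hs' where "hs' = butlast hs"
  have hs: "butlast (gs @ c # hs) = gs @ c # hs'" "butlast (gs @ hs) = gs @ hs'"
    "length hs' = Suc (length xs)"
    using Cons.prems by (auto simp: hs'_def butlast_append)
  define Z where "Z = hecke_row (Suc (i + length gs)) x hs' X"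
  have "hecke_row (Suc i) c gs (hecke_row i x (gs @ c # hs') X) =
      hecke_row (Suc i) c gs (hecke_row i x gs (hecke (i + length gs) (c / x) Z))"
    by (simp add: hecke_row_append Z_def)
  also have "\<dots> = hecke i (c / x) (hecke_row (Suc i) x gs (hecke_row i c gs Z))"
    using Cons.prems assms(1) by (subst hecke_ladder) auto
  also have "hecke_row i c gs Z = hecke_row (Suc (i + length gs)) x hs' (hecke_row i c gs X)"
    unfolding Z_def by (rule hecke_row_commute) simp
  also have "hecke_row (Suc i) x gs \<dots> = hecke_row (Suc i) x (gs @ hs') (hecke_row i c gs X)"
    by (simp add: hecke_row_append)
  finally show ?case
    using Cons.IH[of hs' "Suc i"] Cons.prems hs by (simp add: hecke_rows_commute_high)
qed

lemma hecke_row_trim: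
  assumes "length us \<le> Suc (i + length gs)"
  shows "hecke_row i x (gs @ [g]) X us = hecke_row i x gs X us"
  unfolding hecke_row_append
proof (rule hecke_row_cong)
  fix vs assume "mset vs = mset us"
  from mset_eq_length[OF this] show "hecke_row (i + length gs) x [g] X vs = X vs"
    using assms by (simp add: hecke_short)
qed

text \<open>The omitted boxes act beyond the end of the word.\<close>

lemma hecke_rows_trim:
  "length us \<le> i + length gs \<Longrightarrow> hecke_rows i xs (gs @ [g]) X us = hecke_rows i xs gs X us"
proof (induction xs arbitrary: i g gs X)
  case (Cons x xs)
  show ?case
  proof (cases gs rule: rev_exhaust)
    case (snoc gs' g')
    have "hecke_rows (Suc i) xs (gs' @ [g']) (hecke_row i x gs X) us =
        hecke_rows (Suc i) xs gs' (hecke_row i x gs X) us"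
      by (rule Cons.IH) (use Cons.prems snoc in simp)
    also have "\<dots> = hecke_rows (Suc i) xs gs' (hecke_row i x gs' X) us"
      unfolding snoc
    proof (rule hecke_rows_cong, rule hecke_row_trim)
      fix vs assume "mset vs = mset us"
      from mset_eq_length[OF this] show "length vs \<le> Suc (i + length gs')"
        using Cons.prems snoc by simp
    qed
    finally show ?thesis by (simp add: snoc butlast_append)
  qed simp
qed simp

text \<open>A final letter \<open>n\<close> is never the smaller letter of a descent. The operator
  reaching it is trivial on the left for this reason, and on the right because the word is too
  short.\<close>

lemma hecke_snoc_max:
  assumes "\<And>x. x \<in> set us \<Longrightarrow> x \<le> n"
  shows "hecke i t X (us @ [n]) = hecke i t (\<lambda>v. X (v @ [n])) us"
proof -
  consider "Suc i < length us" | "Suc i = length us" | "length us < Suc i" by linarith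
  then show ?thesis
  proof cases
    case 1
    then show ?thesis by (simp add: hecke_def nth_append list_update_append)
  next
    case 2
    then have "us ! i \<le> n" using assms by simp
    then show ?thesis using 2 by (simp add: hecke_def nth_append)
  qed (simp add: hecke_def)
qed

lemma hecke_row_snoc_max:
  "(\<And>x. x \<in> set us \<Longrightarrow> x \<le> n) \<Longrightarrow>
    hecke_row i x gs X (us @ [n]) = hecke_row i x gs (\<lambda>v. X (v @ [n])) us"
proof (induction gs arbitrary: i us)
  case (Cons g gs)
  have "hecke i (g / x) (hecke_row (Suc i) x gs X) (us @ [n]) =
      hecke i (g / x) (\<lambda>v. hecke_row (Suc i) x gs X (v @ [n])) us"
    by (rule hecke_snoc_max) (rule Cons.prems)
  also have "\<dots> = hecke i (g / x) (hecke_row (Suc i) x gs (\<lambda>v. X (v @ [n]))) us"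
    by (intro hecke_cong Cons.IH) (use Cons.prems mset_eq_setD in blast)
  finally show ?case by simp
qed simp

lemma hecke_rows_snoc_max:
  "(\<And>x. x \<in> set us \<Longrightarrow> x \<le> n) \<Longrightarrow>
    hecke_rows i xs gs X (us @ [n]) = hecke_rows i xs gs (\<lambda>v. X (v @ [n])) us"
proof (induction xs arbitrary: i gs X)
  case (Cons x xs)
  have "hecke_rows (Suc i) xs (butlast gs) (\<lambda>v. hecke_row i x (butlast gs) X (v @ [n])) us =
      hecke_rows (Suc i) xs (butlast gs) (hecke_row i x (butlast gs) (\<lambda>v. X (v @ [n]))) us"
    by (intro hecke_rows_cong hecke_row_snoc_max) (use Cons.prems mset_eq_setD in blast)
  then show ?case
    using Cons by simp
qed simp

text \<open>At a descent within the first \<open>k\<close> letters neither the word nor its exchange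
  has a constant prefix, so \<open>X\<close> vanishes at both.\<close>

lemma hecke_row_constant_prefix:
  assumes "\<And>U. X U \<noteq> 0 \<Longrightarrow> take k U = replicate k z" "i + length gs < k"
  shows "hecke_row i x gs X = X"
  using assms(2)
proof (induction gs arbitrary: i)
  case (Cons g gs)
  have "hecke i t X us = X us" for t us
  proof (cases "Suc i < length us")
    case True
    then obtain vs x y ws where *: "us = vs @ x # y # ws" "length vs = i" by (rule split_at_pair)
    have eq: "u = v" if "X (vs @ u # v # ws) \<noteq> 0" for u v
    proof -
      have "take k (vs @ u # v # ws) ! i = z" "take k (vs @ u # v # ws) ! Suc i = z"
        using assms(1)[OF that] Cons.prems by simp_all
      then show ?thesis using *(2) Cons.prems by (simp add: nth_append)
    qed
    have "y < x \<Longrightarrow> X us = 0" "y < x \<Longrightarrow> X (vs @ y # x # ws) = 0"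
      using eq[of x y] eq[of y x] * by auto
    then show ?thesis using * by (simp add: hecke_at)
  qed (simp add: hecke_short)
  then have "hecke i t X = X" for t by blast
  with Cons show ?case by simp
qed simp

section \<open>Adding one line to every block\<close>

definition stable_word :: "nat \<Rightarrow> (nat \<Rightarrow> nat list) \<Rightarrow> nat \<Rightarrow> nat list" where
  "stable_word n W j = (if j = 0 then W 0 @ [n] else (j - 1) # W j)"

text \<open>The row of \<open>c\<close> in block \<open>k + 1\<close> and the column of
  \<open>c\<close> in block \<open>k\<close> form one line. After sliding, its column part sees the
  sorted word \<open>k # W (Suc k)\<close> and its row part the constant prefix required by
  \<open>\<Psi>'\<close>; both act trivially. The new letter \<open>k\<close> is then fixed in
  front, and \<open>n\<close> is inert at the end.\<close>

lemma quiver_state_stable: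
  fixes c :: "'k::field"
  assumes c: "c \<noteq> 0" and a: "\<And>j. j \<le> n \<Longrightarrow> 0 \<notin> set (a j)"
    and len: "\<And>j. j \<le> n \<Longrightarrow> length (a j) = length (b j)" "\<And>j. j \<le> n \<Longrightarrow> length (W j) = length (b j)"
    and W: "\<And>j x. j \<le> n \<Longrightarrow> x \<in> set (W j) \<Longrightarrow> j - 1 \<le> x \<and> x \<le> n" "\<And>j. j \<le> n \<Longrightarrow> sorted (W j)"
    and V: "d \<le> n" "length V = length (b (n - d))" "\<And>x. x \<in> set V \<Longrightarrow> x \<le> n"
  shows "quiver_state n (\<lambda>j. a j @ [c]) (\<lambda>j. b j @ [c]) (stable_word n W) d (V @ [n]) =
    quiver_state n a b W d V"
  using V
proof (induction d arbitrary: V)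
  case 0
  have "replicate (Suc k) n = replicate k n @ [n]" for k
    by (simp add: replicate_append_same)
  then show ?case by simp
next
  case (Suc d)
  define k where "k = n - Suc d"
  have k: "n - d = Suc k" "Suc k \<le> n" using Suc.prems by (simp_all add: k_def)
  let ?a = "\<lambda>j. a j @ [c]" and ?b = "\<lambda>j. b j @ [c]" and ?W = "stable_word n W"
  define \<Psi> where "\<Psi> = (\<lambda>U. if take (length (b k)) U = replicate (length (b k)) k
            then quiver_state n a b W d (drop (length (b k)) U) else 0)"
  define \<Psi>' where "\<Psi>' = (\<lambda>U. if take (Suc (length (b k))) U = replicate (Suc (length (b k))) k
            then quiver_state n ?a ?b ?W d (drop (Suc (length (b k))) U) else 0)"
  define us where "us = W (Suc k) @ V"
  let ?hs = "b (Suc k) @ [c]"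
  have l: "length (a (Suc k)) = length (b (Suc k))" "length (W (Suc k)) = length (b (Suc k))"
    using len k by simp_all
  have us: "length us = length (b (Suc k)) + length (b k)" "\<And>x. x \<in> set us \<Longrightarrow> x \<le> n"
    using Suc.prems W(1)[of "Suc k"] l k by (auto simp: us_def k_def)
  have "quiver_state n ?a ?b ?W (Suc d) (V @ [n]) =
      hecke_rows 0 (a (Suc k) @ [c]) (b k @ c # ?hs) \<Psi>' (k # us @ [n])"
    unfolding quiver_state.simps k k_def[symmetric]
    by (simp add: \<Psi>'_def stable_word_def us_def cong: if_cong)
  also have "\<dots> = hecke_col 0 c (a (Suc k)) (hecke_rows (Suc 0) (a (Suc k)) (b k @ ?hs)
      (hecke_row 0 c (b k) \<Psi>')) (k # us @ [n])"
    by (subst hecke_rows_slide) (use c a k l in auto)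
  also have "\<dots> = hecke_rows (Suc 0) (a (Suc k)) (b k @ ?hs) (hecke_row 0 c (b k) \<Psi>') (k # us @ [n])"
    by (rule hecke_col_sorted) (use W[of "Suc k"] k l in \<open>auto simp: us_def\<close>)
  also have "hecke_row 0 c (b k) \<Psi>' = \<Psi>'"
    by (rule hecke_row_constant_prefix[where k = "Suc (length (b k))" and z = k])
      (auto simp: \<Psi>'_def split: if_splits)
  also have "hecke_rows (Suc 0) (a (Suc k)) (b k @ ?hs) \<Psi>' (k # us @ [n]) =
      hecke_rows 0 (a (Suc k)) ((b k @ b (Suc k)) @ [c]) (\<lambda>v. \<Psi>' (k # v @ [n])) us"
    using us(2) by (simp add: hecke_rows_Cons hecke_rows_snoc_max)
  \<comment> \<open>The last column \<open>c\<close> belongs to block \<open>k + 1\<close>; once the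
    two new letters are split off, the word is too short for it.\<close>
  also have "\<dots> = hecke_rows 0 (a (Suc k)) (b k @ b (Suc k)) (\<lambda>v. \<Psi>' (k # v @ [n])) us"
    by (rule hecke_rows_trim) (simp add: us)
  also have "\<dots> = hecke_rows 0 (a (Suc k)) (b k @ b (Suc k)) \<Psi> us"
  proof (rule hecke_rows_cong)
    fix v assume v: "mset v = mset us"
    have lv: "length v = length (b (Suc k)) + length (b k)" "set v = set us"
      using mset_eq_length[OF v] mset_eq_setD[OF v] us by simp_all
    have "quiver_state n ?a ?b ?W d (drop (length (b k)) v @ [n]) =
        quiver_state n a b W d (drop (length (b k)) v)"
      by (rule Suc.IH) (use Suc.prems lv k us(2) in \<open>auto dest!: in_set_dropD\<close>)
    then show "\<Psi>' (k # v @ [n]) = \<Psi> v"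
      using lv by (simp add: \<Psi>_def \<Psi>'_def)
  qed
  also have "\<dots> = quiver_state n a b W (Suc d) V"
    unfolding quiver_state.simps k k_def[symmetric] by (simp add: \<Psi>_def us_def cong: if_cong)
  finally show ?case .
qed

text \<open>In block \<open>0\<close> the row of \<open>c\<close> has no boxes, and after splitting
  off the final \<open>n\<close> the column of \<open>c\<close> lies beyond the word.\<close>

theorem quiver_value_stable:
  fixes c :: "'k::field"
  assumes c: "c \<noteq> 0" and a: "\<And>j. j \<le> n \<Longrightarrow> 0 \<notin> set (a j)"
    and len: "\<And>j. j \<le> n \<Longrightarrow> length (a j) = length (b j)" "\<And>j. j \<le> n \<Longrightarrow> length (W j) = length (b j)"
    and W: "\<And>j x. j \<le> n \<Longrightarrow> x \<in> set (W j) \<Longrightarrow> j - 1 \<le> x \<and> x \<le> n" "\<And>j. j \<le> n \<Longrightarrow> sorted (W j)"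
  shows "quiver_value n (\<lambda>j. a j @ [c]) (\<lambda>j. b j @ [c]) (stable_word n W) = quiver_value n a b W"
proof -
  let ?X = "quiver_state n (\<lambda>j. a j @ [c]) (\<lambda>j. b j @ [c]) (stable_word n W) n"
  have "length (a 0) = length (b 0)" using len by simp
  then have "hecke_rows 0 (a 0 @ [c]) (b 0 @ [c]) ?X = hecke_rows 0 (a 0) (b 0 @ [c]) ?X"
    by (cases "b 0") (simp_all add: hecke_rows_append Suc_diff_le)
  moreover have "hecke_rows 0 (a 0) (b 0 @ [c]) ?X (W 0 @ [n]) =
      hecke_rows 0 (a 0) (b 0 @ [c]) (\<lambda>v. ?X (v @ [n])) (W 0)"
    by (rule hecke_rows_snoc_max) (use W(1) in blast)
  moreover have "\<dots> = hecke_rows 0 (a 0) (b 0) (\<lambda>v. ?X (v @ [n])) (W 0)"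
    by (rule hecke_rows_trim) (use len in simp)
  moreover have "\<dots> = hecke_rows 0 (a 0) (b 0) (quiver_state n a b W n) (W 0)"
  proof (rule hecke_rows_cong)
    fix v assume v: "mset v = mset (W 0)"
    show "?X (v @ [n]) = quiver_state n a b W n v"
      by (rule quiver_state_stable)
        (use assms mset_eq_length[OF v] mset_eq_setD[OF v] W(1)[of 0] in auto)
  qed
  ultimately show ?thesis by (simp add: quiver_value_def stable_word_def)
qed

lemma hecke_sorted: "sorted ws \<Longrightarrow> hecke i t X ws = X ws"
  using sorted_nth_mono[of ws i "Suc i"] by (auto simp: hecke_def)

lemma hecke_row_sorted: "sorted ws \<Longrightarrow> hecke_row i x gs X ws = X ws"
  by (induction gs arbitrary: i) (simp_all add: hecke_sorted)

lemma hecke_rows_sorted: "sorted ws \<Longrightarrow> hecke_rows i xs gs X ws = X ws"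
  by (induction xs arbitrary: i gs X) (simp_all add: hecke_row_sorted)

text \<open>\<open>R k\<close> is the word left over for block \<open>k\<close>. Joined to the next
  row word it is sorted, so no operator acts, and its front part is exactly what
  \<open>quiver_state\<close> tests for.\<close>

lemma quiver_value_dominant:
  assumes R: "R n = replicate (length (b n)) n" "W 0 = R 0"
    and WR: "\<And>k. k < n \<Longrightarrow> W (Suc k) @ R k = replicate (length (b k)) k @ R (Suc k)"
    and sorted: "\<And>k. k \<le> n \<Longrightarrow> sorted (R k)" "\<And>k x. k \<le> n \<Longrightarrow> x \<in> set (R k) \<Longrightarrow> k \<le> x"
  shows "quiver_value n a b W = 1"
proof -
  have "quiver_state n a b W d (R (n - d)) = 1" if "d \<le> n" for d
    using that
  proof (induction d)
    case (Suc d)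
    define k where "k = n - Suc d"
    have k: "n - d = Suc k" "k < n" using Suc.prems by (simp_all add: k_def)
    have "sorted (W (Suc k) @ R k)"
      unfolding WR[OF k(2)] using sorted[of "Suc k"] k by (force simp: sorted_append)
    then show ?case
      using Suc.IH Suc.prems WR[OF k(2)]
      unfolding quiver_state.simps k k_def[symmetric] by (simp add: hecke_rows_sorted)
  qed (simp add: R)
  from this[of n] show ?thesis
    using sorted(1)[of 0] by (simp add: quiver_value_def R hecke_rows_sorted)
qed

section \<open>The word of the Zelevinsky permutation\<close>

text \<open>Under the rank conditions, the number of letters at least \<open>l\<close> in the word
  of row block \<open>j \<le> n\<close>. For \<open>j = 0\<close> the missing row \<open>-1\<close>
  of ranks counts as zero.\<close>

definition strip_end :: "nat \<Rightarrow> (nat \<Rightarrow> nat \<Rightarrow> nat) \<Rightarrow> nat \<Rightarrow> nat \<Rightarrow> nat" where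
  "strip_end n r j l =
     (if l < j then dimvec r j else if n < l then 0 else r j l - (if j = 0 then 0 else r (j - 1) l))"

definition row_word :: "nat \<Rightarrow> (nat \<Rightarrow> nat \<Rightarrow> nat) \<Rightarrow> nat \<Rightarrow> nat list" where
  "row_word n r j =
     concat (map (\<lambda>l. replicate (strip_end n r j l - strip_end n r j (Suc l)) l) [0..<Suc n])"

lemma rank_conditionsD1:
  "rank_conditions n r \<Longrightarrow> i < j \<Longrightarrow> j \<le> n \<Longrightarrow> r i j \<le> r i (j - 1) \<and> r i j \<le> r (Suc i) j"
  by (auto simp: rank_conditions_def)

lemma rank_conditionsD2:
  "rank_conditions n r \<Longrightarrow> 0 < i \<Longrightarrow> i \<le> j \<Longrightarrow> j < n \<Longrightarrow>
    r (i - 1) j + r i (Suc j) \<le> r i j + r (i - 1) (Suc j)"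
  by (auto simp: rank_conditions_def)

text \<open>For \<open>j \<le> l < n\<close> this is the second rank condition, or the first one if
  \<open>j = 0\<close>. It makes the truncated differences in \<open>row_word\<close>
  telescope.\<close>

lemma strip_end_antimono:
  assumes r: "rank_conditions n r" and "j \<le> n"
  shows "strip_end n r j (Suc l) \<le> strip_end n r j l"
proof -
  consider "Suc l < j" | "Suc l = j" | "n \<le> l" | "j \<le> l" "l < n" by linarith
  then show ?thesis
  proof cases
    case 4
    show ?thesis
    proof (cases "j = 0")
      case True
      then show ?thesis
        using rank_conditionsD1[OF r, of 0 "Suc l"] 4 by (simp add: strip_end_def)
    next
      case False
      then show ?thesis
        using rank_conditionsD2[OF r, of j l] 4 by (simp add: strip_end_def)
    qed
  qed (use assms in \<open>auto simp: strip_end_def dimvec_def\<close>)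
qed

lemma strip_end_antimono_le:
  assumes "rank_conditions n r" "j \<le> n" "l \<le> l'"
  shows "strip_end n r j l' \<le> strip_end n r j l"
  using lift_Suc_antimono_le[of "strip_end n r j" l l'] strip_end_antimono[OF assms(1,2)] assms(3)
  by simp

lemma strip_end_0 [simp]: "strip_end n r j 0 = dimvec r j"
  by (simp add: strip_end_def dimvec_def)

lemma strip_end_Suc_n [simp]: "j \<le> n \<Longrightarrow> strip_end n r j (Suc n) = 0"
  by (simp add: strip_end_def)

text \<open>Differences of adjacent ranks telescope as long as \<open>k \<le> j\<close>, and later
  terms are whole dimensions. These sums are the parameters of \<open>perm_W\<close>.\<close>

lemma sum_strip_end:
  assumes "rank_conditions n r" "i \<le> n" "j \<le> n"
  shows "(\<Sum>k\<le>i. strip_end n r k j) = rank_ext n r i j"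
  using assms(2)
proof (induction i)
  case 0
  then show ?case using assms by (simp add: strip_end_def rank_ext_def dimvec_def)
next
  case (Suc i)
  then have IH: "(\<Sum>k\<le>i. strip_end n r k j) = rank_ext n r i j" by simp
  consider "j \<le> i" | "j = Suc i" | "Suc i < j" by linarith
  then show ?case
  proof cases
    case 1
    then show ?thesis using assms(3) unfolding sum.atMost_Suc IH by (simp add: strip_end_def rank_ext_def)
  next
    case 2
    then show ?thesis
      using rank_conditionsD1[OF assms(1), of i "Suc i"] Suc.prems
      unfolding sum.atMost_Suc IH by (simp add: strip_end_def rank_ext_def dimvec_def)
  next
    case 3
    then show ?thesis
      using rank_conditionsD1[OF assms(1), of i j] Suc.prems assms(3)
      unfolding sum.atMost_Suc IH by (simp add: strip_end_def rank_ext_def dimvec_def)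
  qed
qed

lemma sum_diff_telescope:
  fixes f :: "nat \<Rightarrow> nat"
  assumes "\<And>l. f (Suc l) \<le> f l"
  shows "(\<Sum>l<k. f l - f (Suc l)) = f 0 - f k"
proof (induction k)
  case (Suc k)
  have "f k \<le> f 0" using lift_Suc_antimono_le[of f 0 k] assms by simp
  then show ?case using Suc assms[of k] by simp
qed simp

lemma length_row_word:
  assumes "rank_conditions n r" "j \<le> n"
  shows "length (row_word n r j) = dimvec r j"
proof -
  have "length (row_word n r j) = (\<Sum>l<Suc n. strip_end n r j l - strip_end n r j (Suc l))"
    by (simp add: row_word_def length_concat comp_def interv_sum_list_conv_sum_set_nat atLeast0LessThan)
  then show ?thesis
    using sum_diff_telescope[of "strip_end n r j" "Suc n"] strip_end_antimono[OF assms] assms by simp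
qed

lemma sorted_concat_replicate: "sorted (concat (map (\<lambda>l. replicate (f l) l) [i..<k]))"
proof (induction k)
  case (Suc k)
  then show ?case by (auto simp: upt_Suc sorted_append)
qed simp

lemma sorted_row_word: "sorted (row_word n r j)"
  unfolding row_word_def by (rule sorted_concat_replicate)

lemma set_row_word: "x \<in> set (row_word n r j) \<Longrightarrow> j - 1 \<le> x \<and> x \<le> n"
proof -
  assume "x \<in> set (row_word n r j)"
  then have x: "x \<le> n" "strip_end n r j x \<noteq> strip_end n r j (Suc x)"
    by (auto simp: row_word_def)
  then have "\<not> Suc x < j" by (auto simp: strip_end_def)
  with x show ?thesis by simp
qed

text \<open>
  The values \<open>s + 1, \<dots>, s + e\<^sub>j\<close> of the \<open>j\<close>-th block are cut into consecutive intervals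
  \<open>strip n r j l\<close>, decreasing in \<open>l\<close>. The Zelevinsky permutation puts the strips with index \<open>l\<close>
  into the \<open>l\<close>-th block of positions.
\<close>

definition strip :: "nat \<Rightarrow> (nat \<Rightarrow> nat \<Rightarrow> nat) \<Rightarrow> nat \<Rightarrow> nat \<Rightarrow> nat list" where
  "strip n r j l = [(\<Sum>k<j. dimvec r k) + strip_end n r j (Suc l) + 1
     ..< (\<Sum>k<j. dimvec r k) + strip_end n r j l + 1]"

text \<open>The strips of block \<open>j\<close> with index at least \<open>l\<close>; together they
  form an initial interval of its values.\<close>

definition head_strips :: "nat \<Rightarrow> (nat \<Rightarrow> nat \<Rightarrow> nat) \<Rightarrow> nat \<Rightarrow> nat \<Rightarrow> nat list" where
  "head_strips n r j l = [(\<Sum>k<j. dimvec r k) + 1 ..< (\<Sum>k<j. dimvec r k) + strip_end n r j l + 1]"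

definition segment :: "nat \<Rightarrow> (nat \<Rightarrow> nat \<Rightarrow> nat) \<Rightarrow> nat \<Rightarrow> nat list" where
  "segment n r l = concat (map (\<lambda>k. strip n r k l) [0..<Suc n])"

lemma head_strips_Suc:
  assumes "rank_conditions n r" "j \<le> n"
  shows "head_strips n r j l = head_strips n r j (Suc l) @ strip n r j l"
proof -
  define s where "s = (\<Sum>k<j. dimvec r k) + 1"
  have "[s..<s + strip_end n r j l] =
      [s..<s + strip_end n r j (Suc l)] @ [s + strip_end n r j (Suc l)..<s + strip_end n r j l]"
    using upt_add_eq_append[of s "s + strip_end n r j (Suc l)"
        "strip_end n r j l - strip_end n r j (Suc l)"] strip_end_antimono[OF assms, of l]
    by simp
  then show ?thesis by (simp add: head_strips_def strip_def s_def)
qed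

text \<open>\<open>W\<close> has the shape of \<open>perm_W\<close> with the three ranks
  \<open>length A\<close>, \<open>length A + length C\<close> and
  \<open>length A + length B\<close>.\<close>

lemma block_swap:
  fixes A B C D :: "nat list"
  assumes f: "map f [1..<N + 1] = A @ B @ C @ D"
    and W: "\<And>p. W p = (if length A < p \<and> p \<le> length A + length C then p + length B
        else if length A + length C < p \<and> p \<le> length A + length B + length C then p - length C
        else p)"
  shows "map (f \<circ> W) [1..<N + 1] = A @ C @ B @ D" and "p \<notin> {1..N} \<Longrightarrow> W p = p"
proof -
  have N: "N = length A + length B + length C + length D"
    using arg_cong[OF f, of length] by simp
  have fq: "f (Suc q) = (A @ B @ C @ D) ! q" if "q < N" for q
    using arg_cong[OF f, of "\<lambda>l. l ! q"] that by simp
  show "map (f \<circ> W) [1..<N + 1] = A @ C @ B @ D"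
  proof (rule nth_equalityI)
    fix p assume "p < length (map (f \<circ> W) [1..<N + 1])"
    then have p: "p < N" by simp
    then have "map (f \<circ> W) [1..<N + 1] ! p = f (W (Suc p))" by simp
    also have "\<dots> = (A @ C @ B @ D) ! p"
    proof -
      consider "p < length A" | "length A \<le> p" "p < length A + length C"
        | "length A + length C \<le> p" "p < length A + length B + length C"
        | "length A + length B + length C \<le> p" by linarith
      then show ?thesis
      proof cases
        case 1
        then show ?thesis using p by (simp add: W fq nth_append)
      next
        case 2
        then obtain k where k: "p = length A + k" by (auto simp: le_iff_add)
        have "W (Suc p) = Suc (length A + (length B + k))" using 2 k by (simp add: W)
        then show ?thesis using 2 N k by (simp add: fq nth_append)
      next
        case 3
        then obtain k where k: "p = length A + (length C + k)" by (auto simp: le_iff_add)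
        have "W (Suc p) = Suc (length A + k)" using 3 k by (simp add: W)
        then show ?thesis using 3 N k by (simp add: fq nth_append)
      next
        case 4
        then obtain k where k: "p = length A + (length B + (length C + k))" by (auto simp: le_iff_add)
        have "W (Suc p) = Suc p" using 4 by (simp add: W)
        moreover have "p = length A + (length C + (length B + k))" using k by simp
        then have "(A @ C @ B @ D) ! p = D ! k" by (simp only: nth_append_length_plus)
        ultimately show ?thesis using p k by (simp add: fq nth_append_length_plus)
      qed
    qed
    finally show "map (f \<circ> W) [1..<N + 1] ! p = (A @ C @ B @ D) ! p" .
  qed (simp add: N)
  show "W p = p" if "p \<notin> {1..N}"
    using that by (auto simp: W N)
qed

section \<open>Words of the partial products of the permutations \<open>perm_W\<close>\<close>

lemma concat_head_strips_0:
  "concat (map (\<lambda>k. head_strips n r k 0) [0..<k]) = [1..<(\<Sum>i<k. dimvec r i) + 1]"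
proof (induction k)
  case (Suc k)
  show ?case
    using upt_add_eq_append[of 1 "(\<Sum>i<k. dimvec r i) + 1" "dimvec r k"]
    by (simp add: upt_Suc[of 0] Suc) (simp add: head_strips_def add.commute)
qed simp

lemma total_dim_lessThan: "total_dim n r = (\<Sum>i<Suc n. dimvec r i)"
  by (simp add: total_dim_def lessThan_Suc_atMost)

lemma length_concat_head_strips:
  assumes "rank_conditions n r" "i \<le> n" "j \<le> n"
  shows "length (concat (map (\<lambda>k. head_strips n r k j) [0..<Suc i])) = rank_ext n r i j"
proof -
  have "length (concat (map (\<lambda>k. head_strips n r k j) [0..<Suc i])) = (\<Sum>k<Suc i. strip_end n r k j)"
    by (simp add: head_strips_def length_concat comp_def interv_sum_list_conv_sum_set_nat
        atLeast0LessThan del: sum.lessThan_Suc)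
  then show ?thesis
    using sum_strip_end[OF assms] by (simp add: lessThan_Suc_atMost)
qed

lemma length_concat_head_strips_Suc:
  assumes "rank_conditions n r" "k \<le> Suc n"
  shows "length (concat (map (\<lambda>k. head_strips n r k l) [0..<k])) =
    length (concat (map (\<lambda>k. head_strips n r k (Suc l)) [0..<k])) +
    length (concat (map (\<lambda>k. strip n r k l) [0..<k]))"
  using assms(2)
proof (induction k)
  case (Suc k)
  then show ?case
    using head_strips_Suc[OF assms(1), of k l] by (simp add: upt_Suc)
qed simp

text \<open>The heads at \<open>l\<close> have total length equal to the sum of the dimensions from
  \<open>l\<close> to \<open>n\<close>; the segment is what they lose in passing to
  \<open>Suc l\<close>.\<close>

lemma length_segment:
  assumes "rank_conditions n r" "l \<le> n"
  shows "length (segment n r l) = dimvec r l"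
proof -
  have "length (concat (map (\<lambda>k. head_strips n r k l) [0..<Suc n])) = (\<Sum>k=l..n. dimvec r k)"
    using length_concat_head_strips[OF assms(1), of n l] assms(2) by (simp add: rank_ext_def)
  moreover have "length (concat (map (\<lambda>k. head_strips n r k (Suc l)) [0..<Suc n])) =
      (\<Sum>k=Suc l..n. dimvec r k)"
  proof (cases "Suc l \<le> n")
    case True
    then show ?thesis
      using length_concat_head_strips[OF assms(1), of n "Suc l"] by (simp add: rank_ext_def)
  next
    case False
    then have "l = n" using assms(2) by simp
    then show ?thesis by (simp add: head_strips_def length_concat comp_def)
  qed
  moreover have "(\<Sum>k=l..n. dimvec r k) = dimvec r l + (\<Sum>k=Suc l..n. dimvec r k)"
    using assms(2) by (simp add: sum.atLeast_Suc_atMost)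
  ultimately show ?thesis
    using length_concat_head_strips_Suc[OF assms(1), of "Suc n" l] by (simp add: segment_def)
qed

text \<open>The word after all factors with second index at most \<open>j\<close> and the factors
  \<open>perm_W n r k (Suc j)\<close> with \<open>k < i\<close>. The strips \<open>j\<close> of the
  blocks up to \<open>i\<close> have been collected; the segments below \<open>j\<close> are
  complete at the end.\<close>

definition sweep_state :: "nat \<Rightarrow> (nat \<Rightarrow> nat \<Rightarrow> nat) \<Rightarrow> nat \<Rightarrow> nat \<Rightarrow> nat list" where
  "sweep_state n r j i =
     concat (map (\<lambda>k. head_strips n r k (Suc j)) [0..<Suc i]) @
     concat (map (\<lambda>k. strip n r k j) [0..<Suc i]) @
     concat (map (\<lambda>k. head_strips n r k j) [Suc i..<Suc n]) @
     concat (map (segment n r) (rev [0..<j]))"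

lemma sweep_state_0:
  assumes "rank_conditions n r"
  shows "sweep_state n r j 0 = concat (map (\<lambda>k. head_strips n r k j) [0..<Suc n]) @
     concat (map (segment n r) (rev [0..<j]))"
proof -
  have "[0..<Suc n] = 0 # [Suc 0..<Suc n]" by (simp add: upt_conv_Cons)
  then show ?thesis
    using head_strips_Suc[OF assms, of 0 j] by (simp add: sweep_state_def upt_Suc[of 0 0])
qed

lemma sweep_state_n:
  "sweep_state n r j n = concat (map (\<lambda>k. head_strips n r k (Suc j)) [0..<Suc n]) @
     concat (map (segment n r) (rev [0..<Suc j]))"
  by (simp add: sweep_state_def segment_def upt_Suc[of 0 j])

text \<open>The factor exchanges the collected strips \<open>B\<close> with the head
  \<open>C\<close> of block \<open>Suc i\<close>; then strip \<open>j\<close> of that block stands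
  next to \<open>B\<close> and joins it.\<close>

lemma sweep_state_step:
  fixes f :: "nat \<Rightarrow> nat"
  assumes r: "rank_conditions n r" and "i < n" "j < n"
    and f: "map f [1..<N + 1] = sweep_state n r j i"
  shows "map (f \<circ> perm_W n r i (Suc j)) [1..<N + 1] = sweep_state n r j (Suc i)"
    and "p \<notin> {1..N} \<Longrightarrow> perm_W n r i (Suc j) p = p"
    and "mset (sweep_state n r j (Suc i)) = mset (sweep_state n r j i)"
proof -
  define A where "A = concat (map (\<lambda>k. head_strips n r k (Suc j)) [0..<Suc i])"
  define B where "B = concat (map (\<lambda>k. strip n r k j) [0..<Suc i])"
  define C where "C = head_strips n r (Suc i) (Suc j)"
  define D where "D = strip n r (Suc i) j @ concat (map (\<lambda>k. head_strips n r k j) [Suc (Suc i)..<Suc n]) @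
     concat (map (segment n r) (rev [0..<j]))"
  have "[Suc i..<Suc n] = Suc i # [Suc (Suc i)..<Suc n]"
    using assms(2) by (simp add: upt_conv_Cons)
  then have old: "sweep_state n r j i = A @ B @ C @ D"
    using head_strips_Suc[OF r, of "Suc i" j] assms(2)
    by (simp add: sweep_state_def A_def B_def C_def D_def)
  have new: "sweep_state n r j (Suc i) = A @ C @ B @ D"
    by (simp add: sweep_state_def A_def B_def C_def D_def upt_Suc[of 0 "Suc i"])
  have "length A = rank_ext n r i (Suc j)"
    unfolding A_def by (rule length_concat_head_strips[OF r]) (use assms in auto)
  moreover have "length A + length B = rank_ext n r i j"
    using length_concat_head_strips_Suc[OF r, of "Suc i" j] length_concat_head_strips[OF r, of i j] assms
    by (simp add: A_def B_def)
  moreover have "length A + length C = rank_ext n r (Suc i) (Suc j)"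
    using length_concat_head_strips[OF r, of "Suc i" "Suc j"] assms
    by (simp add: A_def C_def upt_Suc[of 0 "Suc i"])
  ultimately have W: "perm_W n r i (Suc j) p = (if length A < p \<and> p \<le> length A + length C then p + length B
        else if length A + length C < p \<and> p \<le> length A + length B + length C then p - length C
        else p)" for p
    by (auto simp: perm_W_def Let_def)
  note swap = block_swap[where W = "perm_W n r i (Suc j)", OF f[unfolded old] W]
  show "map (f \<circ> perm_W n r i (Suc j)) [1..<N + 1] = sweep_state n r j (Suc i)"
    unfolding new by (rule swap(1))
  show "perm_W n r i (Suc j) p = p" if "p \<notin> {1..N}"
    by (rule swap(2)) (rule that)
  show "mset (sweep_state n r j (Suc i)) = mset (sweep_state n r j i)"
    unfolding old new by (simp add: union_ac)
qed

lemma foldr_comp_append: "foldr (\<circ>) (fs @ gs) id = foldr (\<circ>) fs id \<circ> foldr (\<circ>) gs id"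
  by (induction fs) (simp_all add: comp_assoc)

lemma sweep_row:
  fixes f :: "nat \<Rightarrow> nat"
  assumes r: "rank_conditions n r" and "j < n" "i \<le> n"
    and f: "map f [1..<N + 1] = sweep_state n r j 0"
  defines "g \<equiv> \<lambda>i. foldr (\<circ>) (map (\<lambda>i. perm_W n r i (Suc j)) [0..<i]) id"
  shows "map (f \<circ> g i) [1..<N + 1] = sweep_state n r j i \<and> (\<forall>p. p \<notin> {1..N} \<longrightarrow> g i p = p) \<and>
    mset (sweep_state n r j i) = mset (sweep_state n r j 0)"
  using assms(3)
proof (induction i)
  case (Suc i)
  then have IH: "map (f \<circ> g i) [1..<N + 1] = sweep_state n r j i"
    "\<And>p. p \<notin> {1..N} \<Longrightarrow> g i p = p" "mset (sweep_state n r j i) = mset (sweep_state n r j 0)"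
    using Suc_leD by blast+
  have g: "g (Suc i) = g i \<circ> perm_W n r i (Suc j)"
    by (simp add: g_def upt_Suc foldr_comp_append del: foldr_append)
  have "i < n" using Suc.prems by simp
  note step = sweep_state_step[OF r this assms(2) IH(1)]
  show ?case
    unfolding g comp_assoc[symmetric] step(1,3) IH(3)
    using IH(2) step(2) by (metis comp_apply)
qed (use f in \<open>simp add: g_def\<close>)

lemma sweep:
  assumes r: "rank_conditions n r" and "j \<le> n"
  defines "N \<equiv> total_dim n r"
    and "g \<equiv> \<lambda>j. foldr (\<circ>) (concat (map (\<lambda>j. map (\<lambda>i. perm_W n r i j) [0..<n]) [1..<Suc j])) id"
  shows "map (g j) [1..<N + 1] = sweep_state n r j 0 \<and> (\<forall>p. p \<notin> {1..N} \<longrightarrow> g j p = p) \<and>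
    mset (sweep_state n r j 0) = mset [1..<N + 1]"
  using assms(2)
proof (induction j)
  case 0
  have "sweep_state n r 0 0 = [1..<N + 1]"
    by (simp add: sweep_state_0[OF r] concat_head_strips_0 N_def total_dim_lessThan del: sum.lessThan_Suc)
  then show ?case by (simp add: g_def)
next
  case (Suc j)
  then have IH: "map (g j) [1..<N + 1] = sweep_state n r j 0"
    "\<And>p. p \<notin> {1..N} \<Longrightarrow> g j p = p" "mset (sweep_state n r j 0) = mset [1..<N + 1]"
    by simp_all
  have g: "g (Suc j) = g j \<circ> foldr (\<circ>) (map (\<lambda>i. perm_W n r i (Suc j)) [0..<n]) id"
    by (simp add: g_def upt_Suc[of _ "Suc j"] foldr_comp_append del: foldr_append)
  have "sweep_state n r j n = sweep_state n r (Suc j) 0"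
    by (simp only: sweep_state_0[OF r] sweep_state_n)
  then have "map (g (Suc j)) [1..<N + 1] = sweep_state n r (Suc j) 0"
    "\<And>p. p \<notin> {1..N} \<Longrightarrow> foldr (\<circ>) (map (\<lambda>i. perm_W n r i (Suc j)) [0..<n]) id p = p"
    "mset (sweep_state n r (Suc j) 0) = mset (sweep_state n r j 0)"
    using sweep_row[OF r _ order_refl IH(1)] Suc.prems unfolding g by (metis Suc_le_lessD)+
  then show ?case
    unfolding IH(3) using IH(2) unfolding g by (metis comp_apply)
qed

lemma zelevinsky_word:
  assumes r: "rank_conditions n r"
  shows "map (zelevinsky n r) [1..<total_dim n r + 1] = concat (map (segment n r) (rev [0..<Suc n]))"
    and "mset (concat (map (segment n r) (rev [0..<Suc n]))) = mset [1..<total_dim n r + 1]"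
    and "p \<notin> {1..total_dim n r} \<Longrightarrow> zelevinsky n r p = p"
proof -
  have z: "zelevinsky n r =
      foldr (\<circ>) (concat (map (\<lambda>j. map (\<lambda>i. perm_W n r i j) [0..<n]) [1..<Suc n])) id"
    by (simp add: zelevinsky_def)
  \<comment> \<open>All strips of smaller index have been split off, so the rest of each block is
    its strip \<open>n\<close>.\<close>
  have "head_strips n r k n = strip n r k n" if "k \<le> n" for k
    using that by (simp add: head_strips_def strip_def)
  then have m: "map (\<lambda>k. head_strips n r k n) [0..<Suc n] = map (\<lambda>k. strip n r k n) [0..<Suc n]"
    by (intro map_cong) simp_all
  have s: "sweep_state n r n 0 = concat (map (segment n r) (rev [0..<Suc n]))"
    unfolding sweep_state_0[OF r] m by (simp add: segment_def upt_Suc[of 0 n])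
  show "map (zelevinsky n r) [1..<total_dim n r + 1] = concat (map (segment n r) (rev [0..<Suc n]))"
    "mset (concat (map (segment n r) (rev [0..<Suc n]))) = mset [1..<total_dim n r + 1]"
    "p \<notin> {1..total_dim n r} \<Longrightarrow> zelevinsky n r p = p"
    using sweep[OF r order_refl] unfolding z s by blast+
qed

lemma zelevinsky_permutes:
  assumes r: "rank_conditions n r"
  shows "zelevinsky n r permutes {1..total_dim n r}"
proof -
  let ?z = "zelevinsky n r" and ?N = "total_dim n r"
  have ms: "mset (map ?z [1..<?N + 1]) = mset [1..<?N + 1]"
    unfolding zelevinsky_word(1)[OF r] by (rule zelevinsky_word(2)[OF r])
  have "?z ` {1..?N} = {1..?N}"
    using mset_eq_setD[OF ms] by (simp add: atLeastLessThanSuc_atLeastAtMost)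
  moreover have "inj_on ?z {1..?N}"
    using mset_eq_imp_distinct_iff[OF ms]
    by (simp add: distinct_map atLeastLessThanSuc_atLeastAtMost)
  ultimately have "bij_betw ?z {1..?N} {1..?N}" by (simp add: bij_betw_def)
  then show ?thesis
    by (rule bij_imp_permutes) (rule zelevinsky_word(3)[OF r])
qed

lemma longest_perm_permutes: "longest_perm N permutes {1..N}"
proof (rule bij_imp_permutes)
  show "bij_betw (longest_perm N) {1..N} {1..N}"
    by (rule bij_betw_byWitness[where f' = "longest_perm N"]) (auto simp: longest_perm_def)
qed (auto simp: longest_perm_def)

lemma zelevinsky_hat_permutes:
  "rank_conditions n r \<Longrightarrow> zelevinsky_hat n r permutes {1..total_dim n r}"
  unfolding zelevinsky_hat_def
  by (intro permutes_compose longest_perm_permutes permutes_inv zelevinsky_permutes)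

section \<open>Reading the word of \<open>zelevinsky_hat\<close> by blocks\<close>

lemma list_all2_concat_map:
  "(\<And>x. x \<in> set xs \<Longrightarrow> list_all2 R (f x) (g x)) \<Longrightarrow> list_all2 R (concat (map f xs)) (concat (map g xs))"
  by (induction xs) (auto intro: list_all2_appendI)

lemma list_all2_replicate:
  "(\<And>v. v \<in> set vs \<Longrightarrow> R v l) \<Longrightarrow> length vs = k \<Longrightarrow> list_all2 R vs (replicate k l)"
  by (auto simp: list_all2_conv_all_nth)

lemma distinct_concat_map_unique:
  assumes "distinct (concat (map f ls))" "x \<in> set ls" "y \<in> set ls" "v \<in> set (f x)" "v \<in> set (f y)"
  shows "x = y"
  using assms by (induction ls) auto

lemma sorted_wrt_concat_map:
  assumes "distinct (concat (map f ls))" "distinct ls" "\<And>x. x \<in> set ls \<Longrightarrow> sorted_wrt (<) (f x)"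
  shows "sorted_wrt (\<lambda>v v'. \<forall>x\<in>set ls. v \<in> set (f x) \<longrightarrow> v' \<in> set (f x) \<longrightarrow> (v :: nat) < v')
    (concat (map f ls))"
proof -
  define P where "P = (\<lambda>v v'. \<forall>x\<in>set ls. v \<in> set (f x) \<longrightarrow> v' \<in> set (f x) \<longrightarrow> (v :: nat) < v')"
  have "sorted_wrt P (concat (map f ks))" if "set ks \<subseteq> set ls" "distinct ks" for ks
    using that
  proof (induction ks)
    case (Cons k ks)
    have "sorted_wrt P (f k)"
      using assms(3)[of k] Cons.prems by (auto intro: sorted_wrt_mono_rel simp: P_def)
    moreover have "P v v'" if "v \<in> set (f k)" "x \<in> set ks" "v' \<in> set (f x)" for v v' x
    proof -
      have "y = k" if "y \<in> set ls" "v \<in> set (f y)" for y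
        using distinct_concat_map_unique[OF assms(1) that(1) _ that(2)] \<open>v \<in> set (f k)\<close> Cons.prems by auto
      moreover have "y = x" if "y \<in> set ls" "v' \<in> set (f y)" for y
        using distinct_concat_map_unique[OF assms(1) that(1) _ that(2)] \<open>v' \<in> set (f x)\<close>
          \<open>x \<in> set ks\<close> Cons.prems by auto
      moreover have "x \<noteq> k" using Cons.prems(2) that(2) by auto
      ultimately show ?thesis by (auto simp: P_def)
    qed
    ultimately show ?case
      using Cons by (auto simp: sorted_wrt_append)
  qed simp
  from this[of ls] show ?thesis using assms(2) by (simp add: P_def)
qed

lemma set_strip:
  assumes "rank_conditions n r" "j \<le> n" "v \<in> set (strip n r j l)"
  shows "(\<Sum>k<j. dimvec r k) < v \<and> v \<le> (\<Sum>k<Suc j. dimvec r k)"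
  using assms(3) strip_end_antimono_le[OF assms(1,2), of 0 l] by (auto simp: strip_def)

lemma sorted_segment:
  assumes "rank_conditions n r"
  shows "sorted_wrt (<) (segment n r l)"
proof -
  have "sorted_wrt (<) (concat (map (\<lambda>k. strip n r k l) [0..<k])) \<and>
      (\<forall>v\<in>set (concat (map (\<lambda>k. strip n r k l) [0..<k])). v \<le> (\<Sum>i<k. dimvec r i))"
    if "k \<le> Suc n" for k
    using that
  proof (induction k)
    case (Suc k)
    then have IH: "sorted_wrt (<) (concat (map (\<lambda>k. strip n r k l) [0..<k]))"
      "\<And>v. v \<in> set (concat (map (\<lambda>k. strip n r k l) [0..<k])) \<Longrightarrow> v \<le> (\<Sum>i<k. dimvec r i)"
      by auto
    have s: "sorted_wrt (<) (strip n r k l)" by (simp add: strip_def)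
    have e: "concat (map (\<lambda>k. strip n r k l) [0..<Suc k]) =
        concat (map (\<lambda>k. strip n r k l) [0..<k]) @ strip n r k l"
      by (simp add: upt_Suc)
    have k: "k \<le> n" using Suc.prems by simp
    show ?case
      unfolding e sorted_wrt_append set_append
      using IH s set_strip[OF assms k, of _ l] by fastforce
  qed simp
  from this[of "Suc n"] show ?thesis by (simp add: segment_def)
qed

lemma head_strips_0_eq:
  assumes "rank_conditions n r" "j \<le> n"
  shows "head_strips n r j 0 = concat (map (strip n r j) (rev [0..<Suc n]))"
proof -
  have "head_strips n r j 0 = head_strips n r j l @ concat (map (strip n r j) (rev [0..<l]))" for l
  proof (induction l)
    case (Suc l)
    then show ?case using head_strips_Suc[OF assms, of l] by (simp add: upt_Suc)
  qed simp
  from this[of "Suc n"] show ?thesis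
    using assms(2) by (simp add: head_strips_def)
qed

lemma rev_block_word:
  "rev (block_word e k) = concat (map (\<lambda>l. replicate (e l) l) (rev [0..<k]))"
  by (simp add: block_word_def rev_concat rev_map comp_def)

lemma length_block_word_dimvec: "length (block_word (dimvec r) (Suc n)) = total_dim n r"
proof -
  have "length (block_word e k) = (\<Sum>i<k. e i)" for e k
    by (induction k) (simp_all add: block_word_Suc, simp add: block_word_def)
  then show ?thesis by (simp add: total_dim_lessThan)
qed

definition block_of :: "nat \<Rightarrow> (nat \<Rightarrow> nat) \<Rightarrow> nat \<Rightarrow> nat" where
  "block_of n e v = block_word e (Suc n) ! (v - 1)"

lemma map_block_of: "map (block_of n (dimvec r)) [1..<total_dim n r + 1] = block_word (dimvec r) (Suc n)"
  by (rule nth_equalityI) (simp_all add: length_block_word_dimvec block_of_def)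

lemma mono_on_block_of: "mono_on {1..total_dim n r} (block_of n (dimvec r))"
proof (rule mono_onI)
  fix v w assume "v \<in> {1..total_dim n r}" "w \<in> {1..total_dim n r}" "v \<le> w"
  moreover have "sorted (block_word (dimvec r) (Suc n))"
    unfolding block_word_def by (rule sorted_concat_replicate)
  ultimately show "block_of n (dimvec r) v \<le> block_of n (dimvec r) w"
    unfolding block_of_def
    by (intro sorted_nth_mono) (auto simp: length_block_word_dimvec)
qed

lemma segments_positions:
  assumes "rank_conditions n r"
  shows "list_all2 (\<lambda>v l. v \<in> set (segment n r l))
    (concat (map (segment n r) (rev [0..<Suc n]))) (rev (block_word (dimvec r) (Suc n)))"
  unfolding rev_block_word
proof (rule list_all2_concat_map, rule list_all2_replicate)
  fix l assume "l \<in> set (rev [0..<Suc n])"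
  then have "l \<le> n" by auto
  then show "length (segment n r l) = dimvec r l" by (rule length_segment[OF assms])
qed

lemma segments_values:
  assumes r: "rank_conditions n r"
  shows "list_all2 (\<lambda>v l. v \<in> set (segment n r l)) [1..<total_dim n r + 1]
    (rev (concat (map (row_word n r) (rev [0..<Suc n]))))"
proof -
  have "[1..<total_dim n r + 1] = concat (map (\<lambda>k. head_strips n r k 0) [0..<Suc n])"
    by (simp only: concat_head_strips_0 total_dim_lessThan)
  moreover have "rev (concat (map (row_word n r) (rev [0..<Suc n]))) =
      concat (map (\<lambda>j. rev (row_word n r j)) [0..<Suc n])"
    by (simp add: rev_concat rev_map comp_def)
  moreover have "list_all2 (\<lambda>v l. v \<in> set (segment n r l))
      (concat (map (\<lambda>k. head_strips n r k 0) [0..<Suc n]))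
      (concat (map (\<lambda>j. rev (row_word n r j)) [0..<Suc n]))"
  proof (rule list_all2_concat_map)
    fix j assume "j \<in> set [0..<Suc n]"
    then have j: "j \<le> n" by auto
    have "rev (row_word n r j) =
        concat (map (\<lambda>l. replicate (strip_end n r j l - strip_end n r j (Suc l)) l) (rev [0..<Suc n]))"
      by (simp add: row_word_def rev_concat rev_map comp_def)
    moreover have "list_all2 (\<lambda>v l. v \<in> set (segment n r l))
        (concat (map (strip n r j) (rev [0..<Suc n])))
        (concat (map (\<lambda>l. replicate (strip_end n r j l - strip_end n r j (Suc l)) l) (rev [0..<Suc n])))"
    proof (rule list_all2_concat_map, rule list_all2_replicate)
      fix l v assume "v \<in> set (strip n r j l)"
      then show "v \<in> set (segment n r l)" using j by (force simp: segment_def)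
    qed (simp add: strip_def)
    ultimately show "list_all2 (\<lambda>v l. v \<in> set (segment n r l)) (head_strips n r j 0) (rev (row_word n r j))"
      by (simp only: head_strips_0_eq[OF r j])
  qed
  ultimately show ?thesis by simp
qed

text \<open>The word has the letter \<open>N + 1 - q p\<close> at \<open>p\<close>, where
  \<open>zelevinsky n r (q p) = N + 1 - p\<close>. Its block is thus the index of the segment
  containing \<open>N + 1 - p\<close>, and cutting the values into strips identifies this index with
  a letter of the row words.\<close>

theorem zelevinsky_hat_word:
  assumes r: "rank_conditions n r"
  defines "N \<equiv> total_dim n r" and "f \<equiv> block_of n (dimvec r)" and "z \<equiv> zelevinsky_hat n r"
  shows "map f (map z [1..<N + 1]) = concat (map (row_word n r) (rev [0..<Suc n]))"
    and "standard_word f N (map z [1..<N + 1])"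
proof -
  let ?Z = "zelevinsky n r" and ?w = "longest_perm N"
  let ?target = "concat (map (row_word n r) (rev [0..<Suc n]))"
  let ?seg = "segment n r" and ?zl = "concat (map (segment n r) (rev [0..<Suc n]))"
  have zl: "map ?Z [1..<N + 1] = ?zl" and ms: "mset ?zl = mset [1..<N + 1]"
    using zelevinsky_word(1,2)[OF r] by (simp_all only: N_def)
  have dist: "distinct ?zl" using mset_eq_imp_distinct_iff[OF ms] by simp
  have Zperm: "?Z permutes {1..N}" using zelevinsky_permutes[OF r] by (simp add: N_def)
  have len: "length ?target = N"
    using list_all2_lengthD[OF segments_values[OF r]] by (simp add: N_def)
  define q where "q = (\<lambda>p. inv ?Z (?w p))"
  have p: "?w p \<in> {1..N} \<and> ?w p = N + 1 - p \<and> q p \<in> {1..N} \<and> ?Z (q p) = ?w p \<and> z p = N + 1 - q p"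
    if "p \<in> {1..N}" for p
  proof -
    have w: "?w p \<in> {1..N}" "?w p = N + 1 - p" using that by (auto simp: longest_perm_def)
    have "q p \<in> {1..N}"
      using permutes_in_image[OF permutes_inv[OF Zperm]] w by (simp add: q_def)
    moreover have "?Z (q p) = ?w p"
      using permutes_inverses(1)[OF Zperm] by (simp add: q_def)
    ultimately show ?thesis
      using w by (auto simp: z_def zelevinsky_hat_def q_def N_def longest_perm_def)
  qed
  have f_seg: "?w p \<in> set (?seg (f (z p))) \<and> f (z p) \<le> n" if "p \<in> {1..N}" for p
  proof -
    have q: "1 \<le> q p" "q p \<le> N" using p[OF that] by auto
    then have "?zl ! (q p - 1) \<in> set (?seg (rev (block_word (dimvec r) (Suc n)) ! (q p - 1)))"
      using list_all2_nthD2[OF segments_positions[OF r], of "q p - 1"]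
      by (simp add: length_block_word_dimvec N_def)
    moreover have "?zl ! (q p - 1) = ?w p"
      using p[OF that] q unfolding zl[symmetric] by simp
    moreover have "rev (block_word (dimvec r) (Suc n)) ! (q p - 1) = f (z p)"
      using p[OF that] q by (simp add: rev_nth length_block_word_dimvec N_def[symmetric] f_def block_of_def)
    moreover have "f (z p) < Suc n"
      unfolding f_def block_of_def
      by (rule set_block_word[where e = "dimvec r"], rule nth_mem)
        (use p[OF that] q in \<open>auto simp: length_block_word_dimvec N_def[symmetric]\<close>)
    ultimately show ?thesis by simp
  qed
  have unique: "l = l'" if "v \<in> set (?seg l)" "v \<in> set (?seg l')" "l \<le> n" "l' \<le> n" for v l l'
    using distinct_concat_map_unique[OF dist _ _ that(1,2)] that(3,4) by simp
  show "map f (map z [1..<N + 1]) = ?target"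
  proof (rule nth_equalityI)
    fix i assume "i < length (map f (map z [1..<N + 1]))"
    then have i: "i < N" by simp
    then have pi: "Suc i \<in> {1..N}" by simp
    have "[1..<N + 1] ! (N - Suc i) \<in> set (?seg (rev ?target ! (N - Suc i)))"
      using list_all2_nthD[OF segments_values[OF r], of "N - Suc i"] i by (simp add: N_def)
    then have "?w (Suc i) \<in> set (?seg (?target ! i))"
      using i by (simp add: rev_nth len longest_perm_def Suc_diff_Suc)
    moreover have "?target ! i \<le> n"
    proof -
      have "?target ! i \<in> set ?target" using i len by (intro nth_mem) simp
      then show ?thesis by (auto dest: set_row_word)
    qed
    ultimately have "f (z (Suc i)) = ?target ! i"
      using unique f_seg[OF pi] by blast
    then show "map f (map z [1..<N + 1]) ! i = ?target ! i" using i by simp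
  qed (simp add: len)
  have "mset (map z [1..<N + 1]) = mset [1..<N + 1]"
  proof -
    have "z permutes {1..N}" using zelevinsky_hat_permutes[OF r] by (simp add: z_def N_def)
    then show ?thesis
      using permutes_image_mset[of z "{1..N}"] by (simp add: atLeastLessThanSuc_atLeastAtMost)
  qed
  moreover have "sorted_wrt (\<lambda>x y. f x = f y \<longrightarrow> x < y) (map z [1..<N + 1])"
    unfolding sorted_wrt_iff_nth_less
  proof (intro allI impI)
    fix i j
    assume ij: "i < j" "j < length (map z [1..<N + 1])"
      and eq: "f (map z [1..<N + 1] ! i) = f (map z [1..<N + 1] ! j)"
    then have i: "Suc i \<in> {1..N}" and j: "Suc j \<in> {1..N}" by auto
    have feq: "f (z (Suc i)) = f (z (Suc j))" using eq ij by simp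
    have "\<not> q (Suc i) < q (Suc j)"
    proof
      \<comment> \<open>Equal blocks put both values into one segment, where the Zelevinsky word
        increases, whereas \<open>N + 1 - p\<close> decreases in \<open>p\<close>.\<close>
      assume lt: "q (Suc i) < q (Suc j)"
      have "sorted_wrt (\<lambda>v v'. \<forall>x\<in>set (rev [0..<Suc n]). v \<in> set (?seg x) \<longrightarrow> v' \<in> set (?seg x) \<longrightarrow> v < v') ?zl"
        by (rule sorted_wrt_concat_map[OF dist]) (auto intro: sorted_segment[OF r])
      then have "\<forall>x\<in>set (rev [0..<Suc n]). ?zl ! (q (Suc i) - 1) \<in> set (?seg x) \<longrightarrow>
          ?zl ! (q (Suc j) - 1) \<in> set (?seg x) \<longrightarrow> ?zl ! (q (Suc i) - 1) < ?zl ! (q (Suc j) - 1)"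
        by (rule sorted_wrt_nth_less) (use lt p[OF i] p[OF j] in \<open>auto simp flip: zl intro!: diff_less_mono\<close>)
      moreover have "?zl ! (q (Suc i) - 1) = ?w (Suc i)" "?zl ! (q (Suc j) - 1) = ?w (Suc j)"
        using p[OF i] p[OF j] unfolding zl[symmetric] by auto
      ultimately have "?w (Suc i) < ?w (Suc j)"
        using f_seg[OF i] f_seg[OF j] feq by auto
      then show False using p[OF i] p[OF j] ij by auto
    qed
    moreover have "q (Suc i) \<noteq> q (Suc j)"
      using p[OF i] p[OF j] ij by auto
    ultimately have "N + 1 - q (Suc i) < N + 1 - q (Suc j)"
      using p[OF i] by (intro diff_less_mono2) auto
    then show "map z [1..<N + 1] ! i < map z [1..<N + 1] ! j"
      using ij p[OF i] p[OF j] by simp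
  qed
  ultimately show "standard_word f N (map z [1..<N + 1])"
    unfolding standard_word_def by blast
qed

section \<open>Effect of raising all ranks\<close>

lemma rank_conditions_add: "rank_conditions n r \<Longrightarrow> rank_conditions n (\<lambda>i j. r i j + m)"
  unfolding rank_conditions_def by (simp add: min_add_distrib_left[symmetric])

text \<open>Differences of ranks do not change. Only one end moves: for \<open>j = 0\<close> the
  rank \<open>r 0 n\<close> against the zero beyond \<open>n\<close>, otherwise the dimension of
  block \<open>j\<close> against \<open>strip_end n r j j\<close>.\<close>

lemma row_word_Suc_rank:
  assumes r: "rank_conditions n r" and "j \<le> n"
  shows "row_word n (\<lambda>i j. r i j + 1) j = stable_word n (row_word n r) j"
proof -
  let ?r = "\<lambda>i j. r i j + 1"
  let ?f = "\<lambda>r l. replicate (strip_end n r j l - strip_end n r j (Suc l)) l"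
  show ?thesis
  proof (cases "j = 0")
    case True
    have "map (?f ?r) [0..<n] = map (?f r) [0..<n]"
      using True by (intro map_cong) (auto simp: strip_end_def)
    moreover have "?f ?r n = ?f r n @ [n]"
      using True by (simp add: strip_end_def replicate_append_same)
    moreover have "[0..<Suc n] = [0..<n] @ [n]" by (simp add: upt_Suc)
    ultimately have "row_word n ?r j = row_word n r j @ [n]"
      by (simp only: row_word_def map_append concat_append list.map concat.simps append_assoc append_Nil2)
    then show ?thesis using True by (simp add: stable_word_def)
  next
    case False
    then obtain k where k: "j = Suc k" by (cases j) auto
    have upt: "[0..<Suc n] = [0..<k] @ k # [Suc k..<Suc n]"
      using assms(2) k upt_add_eq_append[of 0 k "Suc n - k"] by (simp add: upt_conv_Cons)
    have low: "concat (map (?f r) [0..<k]) = []" for r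
      by (auto simp: strip_end_def k)
    have "map (?f ?r) [Suc k..<Suc n] = map (?f r) [Suc k..<Suc n]"
      by (intro map_cong) (auto simp: strip_end_def k)
    moreover have "?f ?r k = k # ?f r k"
    proof -
      have "strip_end n r j j \<le> strip_end n r j k"
        by (rule strip_end_antimono_le[OF r assms(2)]) (simp add: k)
      then have "strip_end n ?r j k - strip_end n ?r j (Suc k) =
          Suc (strip_end n r j k - strip_end n r j (Suc k))"
        using assms(2) by (simp add: strip_end_def k dimvec_def)
      then show ?thesis by simp
    qed
    ultimately show ?thesis
      by (simp only: row_word_def stable_word_def upt map_append concat_append low list.map concat.simps)
        (simp add: k)
  qed
qed

section \<open>Maximal ranks, which give the denominator\<close>

lemma max_rank_same [simp]: "max_rank e i i = e i"
  by (simp add: max_rank_def)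

lemma dimvec_max_rank [simp]: "dimvec (max_rank e) = e"
  by (simp add: dimvec_def fun_eq_iff)

lemma max_rank_Suc_left: "i < j \<Longrightarrow> max_rank e i j = min (e i) (max_rank e (Suc i) j)"
  by (simp add: max_rank_def Min_insert flip: atLeastAtMost_insertL)

lemma max_rank_Suc_right: "i \<le> j \<Longrightarrow> max_rank e i (Suc j) = min (max_rank e i j) (e (Suc j))"
  by (simp add: max_rank_def atLeastAtMostSuc_conv min.commute)

lemma rank_conditions_max_rank: "rank_conditions n (max_rank e)"
  unfolding rank_conditions_def
proof (intro conjI allI impI)
  fix i j assume ij: "i < j \<and> j \<le> n"
  then obtain k where "j = Suc k" "i \<le> k" by (cases j) auto
  then show "max_rank e i j \<le> min (max_rank e i (j - 1)) (max_rank e (i + 1) j)"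
    using max_rank_Suc_left[of i j e] max_rank_Suc_right[of i k e] ij by simp
next
  fix i j assume ij: "0 < i \<and> i \<le> j \<and> j < n"
  then obtain k where k: "i = Suc k" by (cases i) auto
  then have "max_rank e k j = min (e k) (max_rank e i j)"
    "max_rank e k (Suc j) = min (min (e k) (max_rank e i j)) (e (Suc j))"
    "max_rank e i (Suc j) = min (max_rank e i j) (e (Suc j))"
    using max_rank_Suc_left[of k j e] max_rank_Suc_right[of k j e] max_rank_Suc_right[of i j e] ij
    by simp_all
  then show "max_rank e (i - 1) j + max_rank e i (j + 1) \<le> max_rank e i j + max_rank e (i - 1) (j + 1)"
    by (simp add: k)
qed

text \<open>The words \<open>R j\<close> of \<open>quiver_value_dominant\<close> for maximal ranks:
  \<open>max_rank e j l\<close> of the letters are at least \<open>l\<close>, for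
  \<open>j \<le> l \<le> n\<close>.\<close>

definition residual_word :: "nat \<Rightarrow> (nat \<Rightarrow> nat) \<Rightarrow> nat \<Rightarrow> nat list" where
  "residual_word n e j =
     concat (map (\<lambda>l. replicate (max_rank e j l - (if l = n then 0 else max_rank e j (Suc l))) l) [j..<Suc n])"

lemma count_concat_replicate:
  "count (mset (concat (map (\<lambda>l. replicate (f l) l) [i..<k]))) x = (if i \<le> x \<and> x < k then f x else 0)"
proof (induction k)
  case (Suc k)
  then show ?case by (auto simp: upt_Suc)
qed simp

text \<open>Both sides are sorted with the same letters. For the counts,
  \<open>max_rank e k l\<close> is the minimum of \<open>e k\<close> and
  \<open>max_rank e (Suc k) l\<close>, so the latter is the sum of \<open>max_rank e k l\<close> and
  \<open>strip_end\<close> for row \<open>Suc k\<close>.\<close>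

lemma row_word_residual_word:
  assumes "k < n"
  shows "row_word n (max_rank e) (Suc k) @ residual_word n e k =
    replicate (e k) k @ residual_word n e (Suc k)"
proof -
  let ?r = "max_rank e"
  let ?T = "strip_end n ?r (Suc k)"
  have r: "rank_conditions n ?r" by (rule rank_conditions_max_rank)
  have T: "?T l = ?r (Suc k) l - ?r k l" "?r k l = min (e k) (?r (Suc k) l)" if "Suc k \<le> l" "l \<le> n" for l
    using that max_rank_Suc_left[of k l e] by (simp_all add: strip_end_def)
  have le: "x \<le> y" if x: "x \<in> set (row_word n ?r (Suc k))" and y: "y \<in> set (residual_word n e k)" for x y
  proof (rule ccontr)
    assume "\<not> x \<le> y"
    have xn: "x \<le> n" "?T x \<noteq> ?T (Suc x)" using x by (auto simp: row_word_def)
    have yk: "k \<le> y" "?r k y - (if y = n then 0 else ?r k (Suc y)) \<noteq> 0"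
      using y by (auto simp: residual_word_def)
    \<comment> \<open>A letter \<open>x > k\<close> of the row word makes \<open>strip_end\<close>
      positive at \<open>x\<close>, so \<open>e k\<close> is smaller than all of
      \<open>e (Suc k)\<close>, ..., \<open>e x\<close>. The ranks of row \<open>k\<close> are then
      constant up to \<open>x\<close>, and the residual word has no letter below
      \<open>x\<close>.\<close>
    have "Suc k \<le> x" using yk \<open>\<not> x \<le> y\<close> by simp
    then have "e k < ?r (Suc k) x"
      using T[of x] xn strip_end_antimono[OF r, of "Suc k" x] assms by auto
    then have lt: "e k < e t" if "Suc k \<le> t" "t \<le> x" for t
      using that Min_le[of "e ` {Suc k..x}" "e t"] unfolding max_rank_def by fastforce
    have "?r k t = e k" if "k \<le> t" "t \<le> x" for t
      unfolding max_rank_def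
    proof (rule Min_eqI)
      fix u assume "u \<in> e ` {k..t}"
      then obtain i where "u = e i" "k \<le> i" "i \<le> t" by auto
      then show "e k \<le> u" using lt[of i] that by (cases "i = k") auto
    qed (use that in auto)
    then have "?r k y = ?r k (Suc y)" using yk \<open>\<not> x \<le> y\<close> by simp
    then show False using yk xn \<open>\<not> x \<le> y\<close> by (auto split: if_splits)
  qed
  have sL: "sorted (row_word n ?r (Suc k) @ residual_word n e k)"
    using le sorted_row_word[of n ?r "Suc k"] sorted_concat_replicate
    by (auto simp: sorted_append residual_word_def)
  have sR: "sorted (replicate (e k) k @ residual_word n e (Suc k))"
    unfolding sorted_append using sorted_concat_replicate[of _ "Suc k" "Suc n"]
    by (auto simp: residual_word_def simp del: upt_Suc)
  have "mset (row_word n ?r (Suc k) @ residual_word n e k) =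
      mset (replicate (e k) k @ residual_word n e (Suc k))"
  proof (rule multiset_eqI)
    fix x
    have cL: "count (mset (row_word n ?r (Suc k) @ residual_word n e k)) x =
        (if x < Suc n then ?T x - ?T (Suc x) else 0) +
        (if k \<le> x \<and> x < Suc n then ?r k x - (if x = n then 0 else ?r k (Suc x)) else 0)"
      by (simp only: mset_append count_union row_word_def residual_word_def count_concat_replicate) simp
    have cR: "count (mset (replicate (e k) k @ residual_word n e (Suc k))) x =
        (if x = k then e k else 0) +
        (if Suc k \<le> x \<and> x < Suc n then ?r (Suc k) x - (if x = n then 0 else ?r (Suc k) (Suc x)) else 0)"
      by (simp only: mset_append count_union residual_word_def count_concat_replicate) simp
    consider "n < x" | "x < k" | "x = k" | "Suc k \<le> x" "x \<le> n" by linarith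
    then show "count (mset (row_word n ?r (Suc k) @ residual_word n e k)) x =
        count (mset (replicate (e k) k @ residual_word n e (Suc k))) x"
      unfolding cL cR
    proof cases
      case 2
      then show "(if x < Suc n then ?T x - ?T (Suc x) else 0) +
        (if k \<le> x \<and> x < Suc n then ?r k x - (if x = n then 0 else ?r k (Suc x)) else 0) =
        (if x = k then e k else 0) +
        (if Suc k \<le> x \<and> x < Suc n then ?r (Suc k) x - (if x = n then 0 else ?r (Suc k) (Suc x)) else 0)"
        by (simp add: strip_end_def)
    next
      case 3
      then show "(if x < Suc n then ?T x - ?T (Suc x) else 0) +
        (if k \<le> x \<and> x < Suc n then ?r k x - (if x = n then 0 else ?r k (Suc x)) else 0) =
        (if x = k then e k else 0) +
        (if Suc k \<le> x \<and> x < Suc n then ?r (Suc k) x - (if x = n then 0 else ?r (Suc k) (Suc x)) else 0)"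
        using assms T[of "Suc k"] by (simp add: strip_end_def[of n ?r "Suc k" k])
    next
      case 4
      show "(if x < Suc n then ?T x - ?T (Suc x) else 0) +
        (if k \<le> x \<and> x < Suc n then ?r k x - (if x = n then 0 else ?r k (Suc x)) else 0) =
        (if x = k then e k else 0) +
        (if Suc k \<le> x \<and> x < Suc n then ?r (Suc k) x - (if x = n then 0 else ?r (Suc k) (Suc x)) else 0)"
      proof (cases "x = n")
        case True
        then show ?thesis using 4 T[of n] assms by simp
      next
        case False
        then show ?thesis
          using 4 T[of x] T[of "Suc x"] max_rank_Suc_right[of "Suc k" x e] by (auto simp: min_def)
      qed
    qed (use assms in simp)
  qed
  then show ?thesis
    using sL sR properties_for_sort by metis
qed

lemma quiver_value_max_rank:
  assumes "\<And>j. length (b j) = e j"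
  shows "quiver_value n a b (row_word n (max_rank e)) = 1"
proof (rule quiver_value_dominant[where R = "residual_word n e"])
  show "residual_word n e n = replicate (length (b n)) n"
    by (simp add: residual_word_def assms upt_Suc)
  show "row_word n (max_rank e) 0 = residual_word n e 0"
    unfolding row_word_def residual_word_def
    by (intro arg_cong[of _ _ concat] map_cong) (auto simp: strip_end_def)
  show "row_word n (max_rank e) (Suc k) @ residual_word n e k =
      replicate (length (b k)) k @ residual_word n e (Suc k)" if "k < n" for k
    using row_word_residual_word[OF that] by (simp add: assms)
  show "sorted (residual_word n e k)" for k
    unfolding residual_word_def by (rule sorted_concat_replicate)
  show "k \<le> x" if "x \<in> set (residual_word n e k)" for k x
    using that by (auto simp: residual_word_def)
qed

section \<open>Substitution\<close>

text \<open>Regularity and value in one relation, so that both pass through the field operations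
  together.\<close>

definition substitutes_to :: "(qvar \<Rightarrow> 'k::field) \<Rightarrow> qratfun \<Rightarrow> 'k \<Rightarrow> bool" where
  "substitutes_to \<sigma> F y \<longleftrightarrow>
     (\<exists>P Q. F = Fract P Q \<and> poly_subst \<sigma> Q \<noteq> 0 \<and> y = poly_subst \<sigma> P / poly_subst \<sigma> Q)"

lemma substitutes_to_ratfun:
  assumes "substitutes_to \<sigma> F y"
  shows "ratfun_regular \<sigma> F" "ratfun_subst \<sigma> F = y"
  using assms by (auto simp: substitutes_to_def ratfun_regular_def ratfun_subst_Fract)

lemma poly_subst_minus: "poly_subst \<sigma> (- P) = - poly_subst \<sigma> P"
  using poly_subst_add[of \<sigma> P "- P"] by (simp add: eq_neg_iff_add_eq_0 add.commute)

lemma substitutes_to_of_bool: "substitutes_to \<sigma> (of_bool p) (of_bool p)"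
proof -
  have "substitutes_to \<sigma> 0 0" "substitutes_to \<sigma> 1 1"
    unfolding substitutes_to_def
    by (intro exI[of _ 0] exI[of _ 1], simp add: Zero_fract_def)
      (intro exI[of _ 1], simp add: One_fract_def)
  then show ?thesis by simp
qed

lemma substitutes_to_add:
  assumes "substitutes_to \<sigma> F y" "substitutes_to \<sigma> G z"
  shows "substitutes_to \<sigma> (F + G) (y + z)"
proof -
  obtain P Q where F: "F = Fract P Q" "poly_subst \<sigma> Q \<noteq> 0" "y = poly_subst \<sigma> P / poly_subst \<sigma> Q"
    using assms(1) by (auto simp: substitutes_to_def)
  obtain R S where G: "G = Fract R S" "poly_subst \<sigma> S \<noteq> 0" "z = poly_subst \<sigma> R / poly_subst \<sigma> S"
    using assms(2) by (auto simp: substitutes_to_def)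
  have "Q \<noteq> 0" "S \<noteq> 0" using F G by auto
  then show ?thesis
    unfolding substitutes_to_def using F G
    by (intro exI[of _ "P * S + R * Q"] exI[of _ "Q * S"])
      (simp add: poly_subst_add poly_subst_mult add_frac_eq)
qed

lemma substitutes_to_mult:
  assumes "substitutes_to \<sigma> F y" "substitutes_to \<sigma> G z"
  shows "substitutes_to \<sigma> (F * G) (y * z)"
proof -
  obtain P Q where F: "F = Fract P Q" "poly_subst \<sigma> Q \<noteq> 0" "y = poly_subst \<sigma> P / poly_subst \<sigma> Q"
    using assms(1) by (auto simp: substitutes_to_def)
  obtain R S where G: "G = Fract R S" "poly_subst \<sigma> S \<noteq> 0" "z = poly_subst \<sigma> R / poly_subst \<sigma> S"
    using assms(2) by (auto simp: substitutes_to_def)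
  show ?thesis
    unfolding substitutes_to_def using F G
    by (intro exI[of _ "P * R"] exI[of _ "Q * S"]) (simp add: poly_subst_mult)
qed

lemma substitutes_to_one_minus:
  assumes "substitutes_to \<sigma> F y"
  shows "substitutes_to \<sigma> (1 - F) (1 - y)"
proof -
  obtain P Q where "F = Fract P Q" "poly_subst \<sigma> Q \<noteq> 0" "y = poly_subst \<sigma> P / poly_subst \<sigma> Q"
    using assms by (auto simp: substitutes_to_def)
  then have "substitutes_to \<sigma> (- F) (- y)"
    unfolding substitutes_to_def by (intro exI[of _ "- P"] exI[of _ Q]) (simp add: poly_subst_minus)
  then show ?thesis
    using substitutes_to_add[OF substitutes_to_of_bool[of \<sigma> True]] by fastforce
qed

lemma substitutes_to_divide:
  assumes "substitutes_to \<sigma> F y" "substitutes_to \<sigma> G z" "z \<noteq> 0"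
  shows "substitutes_to \<sigma> (F / G) (y / z)"
proof -
  obtain P Q where F: "F = Fract P Q" "poly_subst \<sigma> Q \<noteq> 0" "y = poly_subst \<sigma> P / poly_subst \<sigma> Q"
    using assms(1) by (auto simp: substitutes_to_def)
  obtain R S where G: "G = Fract R S" "poly_subst \<sigma> S \<noteq> 0" "z = poly_subst \<sigma> R / poly_subst \<sigma> S"
    using assms(2) by (auto simp: substitutes_to_def)
  show ?thesis
    unfolding substitutes_to_def using F G assms(3)
    by (intro exI[of _ "P * S"] exI[of _ "Q * R"]) (simp add: poly_subst_mult)
qed

lemma substitutes_to_var: "substitutes_to \<sigma> (var v) (\<sigma> v)"
  unfolding substitutes_to_def var_def
  by (intro exI[of _ "Poly_Mapping.single (Poly_Mapping.single v 1) 1"] exI[of _ 1])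
    (simp add: poly_subst_single monom_subst_def)

lemma substitutes_to_hecke:
  assumes "substitutes_to \<sigma> t t'" "\<And>ws. substitutes_to \<sigma> (X ws) (X' ws)"
  shows "substitutes_to \<sigma> (hecke i t X ws) (hecke i t' X' ws)"
  using assms
  by (auto simp: hecke_def intro!: substitutes_to_add substitutes_to_mult substitutes_to_one_minus)

lemma substitutes_to_hecke_row:
  assumes "list_all2 (substitutes_to \<sigma>) gs gs'" "substitutes_to \<sigma> x x'" "x' \<noteq> 0"
    and "\<And>ws. substitutes_to \<sigma> (X ws) (X' ws)"
  shows "substitutes_to \<sigma> (hecke_row i x gs X ws) (hecke_row i x' gs' X' ws)"
  using assms(1)
proof (induction gs gs' arbitrary: i ws rule: list_all2_induct)
  case (Cons g gs g' gs')
  then show ?case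
    using assms(2,3) by (auto intro!: substitutes_to_hecke substitutes_to_divide)
qed (simp add: assms)

lemma substitutes_to_hecke_rows:
  assumes "list_all2 (substitutes_to \<sigma>) xs xs'" "0 \<notin> set xs'" "list_all2 (substitutes_to \<sigma>) gs gs'"
    and "\<And>ws. substitutes_to \<sigma> (X ws) (X' ws)"
  shows "substitutes_to \<sigma> (hecke_rows i xs gs X ws) (hecke_rows i xs' gs' X' ws)"
  using assms
proof (induction xs xs' arbitrary: i gs gs' X X' rule: list_all2_induct)
  case (Cons x xs x' xs')
  have "list_all2 (substitutes_to \<sigma>) (butlast gs) (butlast gs')"
    using Cons.prems(2) by (simp add: butlast_conv_take list_all2_lengthD list_all2_takeI)
  with Cons show ?case
    by (auto intro!: Cons.IH substitutes_to_hecke_row)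
qed simp

text \<open>The only divisions are by entries of the lists \<open>a\<close>, whose images are
  nonzero.\<close>

lemma substitutes_to_quiver_value:
  assumes a: "\<And>j. list_all2 (substitutes_to \<sigma>) (a j) (a' j)" "\<And>j. 0 \<notin> set (a' j)"
    and b: "\<And>j. list_all2 (substitutes_to \<sigma>) (b j) (b' j)"
  shows "substitutes_to \<sigma> (quiver_value n a b W) (quiver_value n a' b' W)"
proof -
  have len: "length (b j) = length (b' j)" for j using b list_all2_lengthD by blast
  have "substitutes_to \<sigma> (quiver_state n a b W d V) (quiver_state n a' b' W d V)" for d V
  proof (induction d arbitrary: V)
    case (Suc d)
    have "substitutes_to \<sigma> 0 0" using substitutes_to_of_bool[of \<sigma> False] by simp
    then show ?case
      unfolding quiver_state.simps len
      by (intro substitutes_to_hecke_rows a list_all2_appendI b) (simp add: Suc.IH)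
  qed (simp add: len substitutes_to_of_bool del: of_bool_eq_0_iff)
  then show ?thesis
    unfolding quiver_value_def by (intro substitutes_to_hecke_rows a b)
qed

lemma var_eq_iff [simp]: "var v = var w \<longleftrightarrow> v = w"
proof
  assume eq: "var v = var w"
  define P where "P = (\<lambda>u :: qvar. Poly_Mapping.single (Poly_Mapping.single u (1 :: nat)) (1 :: int))"
  have keys: "Poly_Mapping.keys (P u) = {Poly_Mapping.single u 1}" for u
    unfolding P_def keys_single by simp
  have "var u = Fract (P u) 1" for u by (simp add: var_def P_def)
  then have "P v = P w" using eq by (simp add: eq_fract)
  then have "Poly_Mapping.single v (1 :: nat) = Poly_Mapping.single w 1"
    using keys by (metis singleton_inject)
  then show "v = w"
    by (metis keys_single singleton_inject zero_neq_one)
qed simp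

lemma var_nonzero [simp]: "var v \<noteq> 0"
proof
  assume "var v = 0"
  then have "Poly_Mapping.single (Poly_Mapping.single v 1) (1 :: int) = 0"
    by (simp add: var_def eq_fract Zero_fract_def)
  then show False by (metis keys_single keys_zero insert_not_empty zero_neq_one)
qed

section \<open>From blocks of variables to quiver polynomials\<close>

definition block :: "(nat \<Rightarrow> nat) \<Rightarrow> (nat \<Rightarrow> nat \<Rightarrow> 'k) \<Rightarrow> nat \<Rightarrow> 'k list" where
  "block e x j = map (x j) [1..<e j + 1]"

lemma length_block [simp]: "length (block e x j) = e j"
  by (simp add: block_def)

lemma map_concat_blocks:
  assumes "length (concat (map (block e x) is)) = N"
  shows "map (concat_blocks is e x) [1..<N + 1] = concat (map (block e x) is)"
  by (rule nth_equalityI) (use assms in \<open>simp_all add: concat_blocks_def block_def[abs_def]\<close>)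

lemma length_blocks: "length (concat (map (block (dimvec r) x) [0..<Suc n])) = total_dim n r"
proof -
  have "length (concat (map (block e x) [0..<k])) = (\<Sum>i<k. e i)" for e k
    by (induction k) (simp_all add: upt_Suc)
  then show ?thesis by (simp only: total_dim_lessThan)
qed

lemma length_rev_blocks: "length (concat (map (block (dimvec r) x) (rev [0..<Suc n]))) = total_dim n r"
proof -
  have "length (concat (map (block e x) (rev [0..<k]))) = (\<Sum>i<k. e i)" for e k
    by (induction k) (simp_all add: upt_Suc)
  then show ?thesis by (simp only: total_dim_lessThan)
qed

text \<open>Combines the Fomin-Kirillov product, the relabelling of values by blocks and the removal
  of forced crossings. The product of crossing factors depends on \<open>r\<close> only through its
  dimension vector.\<close>

lemma grothendieck_zelevinsky_hat:
  fixes x y :: "nat \<Rightarrow> nat \<Rightarrow> 'k::field"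
  assumes r: "rank_conditions n r"
    and dist: "distinct (concat (map (block (dimvec r) x) (rev [0..<Suc n])))"
    and nz: "\<And>j. 0 \<notin> set (block (dimvec r) x j)"
  shows "grothendieck (total_dim n r) (zelevinsky_hat n r)
      (concat_blocks (rev [0..<n + 1]) (dimvec r) x) (concat_blocks [0..<n + 1] (dimvec r) y) =
    (\<Prod>i<n. crossing_factor (block (dimvec r) x) (block (dimvec r) y) (n - i)) *
    quiver_value n (block (dimvec r) x) (block (dimvec r) y) (row_word n r)"
proof -
  let ?N = "total_dim n r" and ?z = "zelevinsky_hat n r" and ?f = "block_of n (dimvec r)"
  let ?a = "concat_blocks (rev [0..<n + 1]) (dimvec r) x"
  let ?b = "concat_blocks [0..<n + 1] (dimvec r) y"
  have a: "map ?a [1..<?N + 1] = concat (map (block (dimvec r) x) (rev [0..<Suc n]))"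
    using map_concat_blocks[OF length_rev_blocks] by simp
  have b: "map ?b [1..<?N + 1] = concat (map (block (dimvec r) y) [0..<Suc n])"
    using map_concat_blocks[OF length_blocks] by simp
  have "inj_on ?a {1..?N}"
    using dist unfolding a[symmetric] distinct_map by (simp add: atLeastLessThanSuc_atLeastAtMost)
  moreover have "?a p \<noteq> 0" if "1 \<le> p" "p \<le> ?N" for p
  proof -
    have "?a p \<in> set (map ?a [1..<?N + 1])" using that by auto
    then show ?thesis unfolding a using nz by auto
  qed
  ultimately have "grothendieck ?N ?z ?a ?b =
      hecke_rows 0 (concat (map (block (dimvec r) x) (rev [0..<Suc n])))
        (concat (map (block (dimvec r) y) [0..<Suc n])) (\<lambda>U. of_bool (U = [1..<?N + 1]))
        (map ?z [1..<?N + 1])"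
    unfolding a[symmetric] b[symmetric]
    by (intro grothendieck_eq_hecke_rows zelevinsky_hat_permutes[OF r])
  also have "\<dots> = hecke_rows 0 (concat (map (block (dimvec r) x) (rev [0..<Suc n])))
        (concat (map (block (dimvec r) y) [0..<Suc n]))
        (\<lambda>U. of_bool (U = block_word (dimvec r) (Suc n)))
        (map ?f (map ?z [1..<?N + 1]))"
  proof (rule hecke_rows_standard_word[OF _ mono_on_block_of zelevinsky_hat_word(2)[OF r]])
    fix ws assume "standard_word ?f ?N ws"
    from standard_word_eq_iff[OF mono_on_block_of this]
    show "of_bool (ws = [1..<?N + 1]) = (of_bool (map ?f ws = block_word (dimvec r) (Suc n)) :: 'k)"
      by (simp only: map_block_of)
  qed
  also have "map ?f (map ?z [1..<?N + 1]) = concat (map (row_word n r) (rev [0..<Suc n]))"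
    by (rule zelevinsky_hat_word(1)[OF r])
  also have "hecke_rows 0 (concat (map (block (dimvec r) x) (rev [0..<Suc n])))
        (concat (map (block (dimvec r) y) [0..<Suc n]))
        (\<lambda>U. of_bool (U = block_word (dimvec r) (Suc n)))
        (concat (map (row_word n r) (rev [0..<Suc n]))) =
    (\<Prod>i<n. crossing_factor (block (dimvec r) x) (block (dimvec r) y) (n - i)) *
    quiver_value n (block (dimvec r) x) (block (dimvec r) y) (row_word n r)"
    using full_state_eq_quiver_value[of n "block (dimvec r) x" "block (dimvec r) y" "row_word n r"]
      length_row_word[OF r] set_row_word by simp
  finally show ?thesis .
qed

lemma distinct_concat_blocks:
  assumes "distinct is" "\<And>i j p q. x i p = x j q \<Longrightarrow> i = j \<and> p = q"
  shows "distinct (concat (map (block e x) is))"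
  using assms(1)
proof (induction "is")
  case (Cons i "is")
  have "distinct (block e x i)"
    using assms(2) by (auto simp: block_def distinct_map inj_on_def)
  moreover have "set (block e x i) \<inter> set (block e x j) = {}" if "j \<in> set is" for j
    using assms(2)[of i _ j] Cons.prems that by (auto simp: block_def)
  ultimately show ?case using Cons by auto
qed simp

text \<open>Numerator and denominator share the product of crossing factors, which is nonzero for
  independent variables; the other factor of the denominator is \<open>1\<close>.\<close>

lemma double_quiver_polynomial_eq:
  assumes r: "rank_conditions n r"
  shows "double_quiver_polynomial n r =
    quiver_value n (block (dimvec r) (\<lambda>i p. var (VarA i p))) (block (dimvec r) (\<lambda>i p. var (VarB i p)))
      (row_word n r)"
proof -
  let ?e = "dimvec r"
  let ?x = "\<lambda>i p. var (VarA i p)" and ?y = "\<lambda>i p. var (VarB i p)"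
  let ?c = "\<Prod>i<n. crossing_factor (block ?e ?x) (block ?e ?y) (n - i)"
  have dist: "distinct (concat (map (block ?e ?x) (rev [0..<Suc n])))"
    by (rule distinct_concat_blocks) auto
  have nz: "0 \<notin> set (block ?e ?x j)" for j by (auto simp: block_def)
  have "total_dim n (max_rank ?e) = total_dim n r" by (simp add: total_dim_def)
  then have "grothendieck (total_dim n r) (zelevinsky_hat n (max_rank ?e))
      (concat_blocks (rev [0..<n + 1]) ?e ?x) (concat_blocks [0..<n + 1] ?e ?y) = ?c"
    using grothendieck_zelevinsky_hat[OF rank_conditions_max_rank[of n ?e], where x = ?x and y = ?y] dist nz
    by (simp add: quiver_value_max_rank)
  moreover have "?c \<noteq> 0"
  proof -
    have "1 - ?y i p / ?x j q \<noteq> 0" for i j p q by simp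
    then show ?thesis
      by (auto simp: crossing_factor_def prod_list_zero_iff block_def)
  qed
  ultimately show ?thesis
    unfolding double_quiver_polynomial_def Let_def
    using grothendieck_zelevinsky_hat[OF r dist nz, of ?y] by simp
qed

lemma quiver_value_cong:
  assumes "\<And>j. j \<le> n \<Longrightarrow> W j = W' j"
  shows "quiver_value n a b W = quiver_value n a b W'"
proof -
  have "quiver_state n a b W d = quiver_state n a b W' d" for d
  proof (induction d)
    case (Suc d)
    show ?case
      by (rule ext) (unfold quiver_state.simps Suc.IH, simp add: assms)
  qed (simp add: fun_eq_iff)
  then show ?thesis by (simp add: quiver_value_def assms)
qed

text \<open>Each unit of \<open>m\<close> adds one line with \<open>c = 1\<close> by
  \<open>quiver_value_stable\<close>.\<close>

lemma quiver_value_add_ones: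
  fixes a b :: "nat \<Rightarrow> 'k::field list"
  assumes r: "rank_conditions n r" and len: "\<And>j. length (a j) = dimvec r j" "\<And>j. length (b j) = dimvec r j"
    and a: "\<And>j. 0 \<notin> set (a j)"
  shows "quiver_value n (\<lambda>j. a j @ replicate m 1) (\<lambda>j. b j @ replicate m 1)
      (row_word n (\<lambda>i j. r i j + m)) = quiver_value n a b (row_word n r)"
proof (induction m)
  case (Suc m)
  let ?r = "\<lambda>i j. r i j + m"
  let ?a = "\<lambda>j. a j @ replicate m 1" and ?b = "\<lambda>j. b j @ replicate m 1"
  have r': "rank_conditions n ?r" by (rule rank_conditions_add[OF r])
  have "(\<lambda>i j. r i j + Suc m) = (\<lambda>i j. ?r i j + 1)" by simp
  then have "quiver_value n (\<lambda>j. a j @ replicate (Suc m) 1) (\<lambda>j. b j @ replicate (Suc m) 1)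
      (row_word n (\<lambda>i j. r i j + Suc m)) =
    quiver_value n (\<lambda>j. ?a j @ [1]) (\<lambda>j. ?b j @ [1]) (row_word n (\<lambda>i j. ?r i j + 1))"
    by (simp only: append_assoc replicate_append_same replicate_Suc)
  also have "\<dots> = quiver_value n (\<lambda>j. ?a j @ [1]) (\<lambda>j. ?b j @ [1]) (stable_word n (row_word n ?r))"
    by (rule quiver_value_cong) (rule row_word_Suc_rank[OF r'])
  also have "\<dots> = quiver_value n ?a ?b (row_word n ?r)"
  proof (rule quiver_value_stable)
    show "length (row_word n ?r j) = length (b j @ replicate m 1)" if "j \<le> n" for j
      using length_row_word[OF r' that] len by (simp add: dimvec_def)
  qed (use len a set_row_word sorted_row_word in auto)
  finally show ?case using Suc.IH by simp
qed simp

theorem theorem9p3: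
  fixes n m :: nat and r :: "nat \<Rightarrow> nat \<Rightarrow> nat"
  assumes "n \<ge> 1" and "rank_conditions n r"
  shows "let \<sigma> = case_qvar (pad_ones (dimvec r) (\<lambda>i p. var (VarA i p)))
                           (pad_ones (dimvec r) (\<lambda>i p. var (VarB i p)));
             K = double_quiver_polynomial n (\<lambda>i j. r i j + m)
         in ratfun_regular \<sigma> K \<and> ratfun_subst \<sigma> K = double_quiver_polynomial n r"
proof -
  let ?x = "\<lambda>i p. var (VarA i p)" and ?y = "\<lambda>i p. var (VarB i p)"
  let ?r = "\<lambda>i j. r i j + m"
  define \<sigma> where "\<sigma> = case_qvar (pad_ones (dimvec r) ?x) (pad_ones (dimvec r) ?y)"
  have pad: "block (dimvec ?r) (pad_ones (dimvec r) x) j = block (dimvec r) x j @ replicate m 1"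
    for x :: "nat \<Rightarrow> nat \<Rightarrow> qratfun" and j
  proof -
    have "[1..<dimvec ?r j + 1] = [1..<dimvec r j + 1] @ [dimvec r j + 1..<dimvec r j + 1 + m]"
      using upt_add_eq_append[of 1 "dimvec r j + 1" m] by (simp add: dimvec_def add.commute add.left_commute)
    moreover have "map (pad_ones (dimvec r) x j) [1..<dimvec r j + 1] = map (x j) [1..<dimvec r j + 1]"
      by (intro map_cong) (auto simp: pad_ones_def)
    moreover have "map (pad_ones (dimvec r) x j) [dimvec r j + 1..<dimvec r j + 1 + m] = replicate m 1"
      by (rule nth_equalityI) (auto simp: pad_ones_def)
    ultimately show ?thesis by (simp add: block_def)
  qed
  have subst: "list_all2 (substitutes_to \<sigma>) (block e (\<lambda>i p. var (C i p)) j) (block e (\<lambda>i p. \<sigma> (C i p)) j)"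
    for e C j
    by (simp add: block_def list_all2_conv_all_nth substitutes_to_var)
  \<comment> \<open>Regularity: every variable of the blocks \<open>a\<close> is sent to a variable
    or to \<open>1\<close>, never to \<open>0\<close>.\<close>
  have "substitutes_to \<sigma> (double_quiver_polynomial n ?r)
      (quiver_value n (block (dimvec ?r) (\<lambda>i p. \<sigma> (VarA i p))) (block (dimvec ?r) (\<lambda>i p. \<sigma> (VarB i p)))
        (row_word n ?r))"
    unfolding double_quiver_polynomial_eq[OF rank_conditions_add[OF assms(2)]]
    by (rule substitutes_to_quiver_value[OF subst _ subst]) (auto simp: block_def \<sigma>_def pad_ones_def)
  also have "quiver_value n (block (dimvec ?r) (\<lambda>i p. \<sigma> (VarA i p))) (block (dimvec ?r) (\<lambda>i p. \<sigma> (VarB i p)))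
        (row_word n ?r) =
      quiver_value n (\<lambda>j. block (dimvec r) ?x j @ replicate m 1) (\<lambda>j. block (dimvec r) ?y j @ replicate m 1)
        (row_word n ?r)"
  proof -
    have "(\<lambda>i p. \<sigma> (VarA i p)) = pad_ones (dimvec r) ?x" "(\<lambda>i p. \<sigma> (VarB i p)) = pad_ones (dimvec r) ?y"
      by (simp_all add: \<sigma>_def)
    moreover have "block (dimvec ?r) (pad_ones (dimvec r) x) = (\<lambda>j. block (dimvec r) x j @ replicate m 1)"
      for x :: "nat \<Rightarrow> nat \<Rightarrow> qratfun"
      by (rule ext) (rule pad)
    ultimately show ?thesis by (simp only:)
  qed
  also have "\<dots> = double_quiver_polynomial n r"
    unfolding double_quiver_polynomial_eq[OF assms(2)]
    by (rule quiver_value_add_ones[OF assms(2)]) (auto simp: block_def)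
  finally show ?thesis
    using substitutes_to_ratfun unfolding Let_def \<sigma>_def by blast
qed

end
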